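(* If $T$ is a theory such that ${\rm LZFC}\subseteq T$ and $T\vdash \text{V-P-H}$, then ${\rm ZFC}\subseteq T+VP$ (i.e., $T+VP$ proves every axiom of ZFC).
   Context: Theories are first-order theories in the language of set theory $\{\in\}$; $S\subseteq T$ means that every theorem of $S$ is a theorem of $T$. BST is the theory with axioms: Empty set, Extensionality, Pair, Union, Cartesian Product, "$\omega$ exists", $\Delta_0$-Separation. $Loc({\rm ZFC})$ is the statement $\forall x\exists y(x\in y\wedge Tr(y)\wedge (y,\in)\models{\rm ZFC})$, where $Tr(y)$ means $y$ is transitive; ${\rm LZFC}={\rm BST}+Loc({\rm ZFC})$. V-P-H is the statement: for every infinite set $A$ there is a binary relation $R\subset A\times A$ such that the graph $(A,R)$ is rigid, i.e., the only endomorphism of $(A,R)$ is the identity, where an endomorphism is a map $f:A\to A$ such that $(x,y)\in R\Rightarrow (f(x),f(y))\in R$ for all $x,y\in A$. $VP$ (Vopěnka's Principle) is the scheme consisting of the following statement for each formula $\phi(x)$ of the language $\{\in\}$ (set parameters allowed), where $X_\phi=\{x:\phi(x)\}$: if $X_\phi$ is a proper class of structures of some fixed first-order language, then there are distinct $x,y\in X_\phi$ and an elementary embedding $j:x\rightarrow y$ (possibly trivial, i.e. $x\prec y$). *)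

theory Defs
  imports Main
begin

section \<open>First-order logic over the language of set theory\<close>

text \<open>
  Formulas of the language with one binary relation symbol (membership) and equality, with
  de Bruijn indices. There are no terms besides variables, so that substitution is renaming.
\<close>

datatype fm =
    MemF nat nat
  | EqF nat nat
  | BotF
  | ImpF fm fm
  | AllF fm

abbreviation NegF :: "fm \<Rightarrow> fm" where "NegF \<phi> \<equiv> ImpF \<phi> BotF"
abbreviation AndF :: "fm \<Rightarrow> fm \<Rightarrow> fm" where "AndF \<phi> \<psi> \<equiv> NegF (ImpF \<phi> (NegF \<psi>))"
abbreviation OrF :: "fm \<Rightarrow> fm \<Rightarrow> fm" where "OrF \<phi> \<psi> \<equiv> ImpF (NegF \<phi>) \<psi>"
abbreviation IffF :: "fm \<Rightarrow> fm \<Rightarrow> fm" where "IffF \<phi> \<psi> \<equiv> AndF (ImpF \<phi> \<psi>) (ImpF \<psi> \<phi>)"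
abbreviation ExF :: "fm \<Rightarrow> fm" where "ExF \<phi> \<equiv> NegF (AllF (NegF \<phi>))"

primrec fv :: "fm \<Rightarrow> nat set" where
  "fv (MemF i j) = {i, j}"
| "fv (EqF i j) = {i, j}"
| "fv BotF = {}"
| "fv (ImpF \<phi> \<psi>) = fv \<phi> \<union> fv \<psi>"
| "fv (AllF \<phi>) = {i. Suc i \<in> fv \<phi>}"

primrec ren :: "(nat \<Rightarrow> nat) \<Rightarrow> fm \<Rightarrow> fm" where
  "ren \<rho> (MemF i j) = MemF (\<rho> i) (\<rho> j)"
| "ren \<rho> (EqF i j) = EqF (\<rho> i) (\<rho> j)"
| "ren \<rho> BotF = BotF"
| "ren \<rho> (ImpF \<phi> \<psi>) = ImpF (ren \<rho> \<phi>) (ren \<rho> \<psi>)"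
| "ren \<rho> (AllF \<phi>) = AllF (ren (case_nat 0 (Suc \<circ> \<rho>)) \<phi>)"

text \<open>Replace variable 0 by \<open>t\<close> and lower the other variables by one.\<close>

definition inst :: "fm \<Rightarrow> nat \<Rightarrow> fm" where
  "inst \<phi> t = ren (case_nat t id) \<phi>"

text \<open>Natural deduction for classical first-order logic with equality.\<close>

inductive proves :: "fm set \<Rightarrow> fm \<Rightarrow> bool" (infix \<open>\<turnstile>\<close> 45) where
  Assm: "\<phi> \<in> \<Gamma> \<Longrightarrow> \<Gamma> \<turnstile> \<phi>"
| ImpI: "insert \<phi> \<Gamma> \<turnstile> \<psi> \<Longrightarrow> \<Gamma> \<turnstile> ImpF \<phi> \<psi>"
| ImpE: "\<Gamma> \<turnstile> ImpF \<phi> \<psi> \<Longrightarrow> \<Gamma> \<turnstile> \<phi> \<Longrightarrow> \<Gamma> \<turnstile> \<psi>"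
| Raa: "insert (NegF \<phi>) \<Gamma> \<turnstile> BotF \<Longrightarrow> \<Gamma> \<turnstile> \<phi>"
| AllI: "ren Suc ` \<Gamma> \<turnstile> \<phi> \<Longrightarrow> \<Gamma> \<turnstile> AllF \<phi>"
| AllE: "\<Gamma> \<turnstile> AllF \<phi> \<Longrightarrow> \<Gamma> \<turnstile> inst \<phi> t"
| EqI: "\<Gamma> \<turnstile> EqF t t"
| EqE: "\<Gamma> \<turnstile> EqF s t \<Longrightarrow> \<Gamma> \<turnstile> inst \<phi> s \<Longrightarrow> \<Gamma> \<turnstile> inst \<phi> t"

definition sentence :: "fm \<Rightarrow> bool" where
  "sentence \<phi> \<longleftrightarrow> fv \<phi> = {}"

definition is_theory :: "fm set \<Rightarrow> bool" where
  "is_theory T \<longleftrightarrow> (\<forall>\<phi>\<in>T. sentence \<phi>)"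

definition theorems :: "fm set \<Rightarrow> fm set" where
  "theorems T = {\<phi>. sentence \<phi> \<and> T \<turnstile> \<phi>}"

definition subtheory :: "fm set \<Rightarrow> fm set \<Rightarrow> bool" (infix \<open>\<sqsubseteq>\<^sub>T\<close> 50) where
  "S \<sqsubseteq>\<^sub>T T \<longleftrightarrow> theorems S \<subseteq> theorems T"

inductive delta0 :: "fm \<Rightarrow> bool" where
  "delta0 (MemF i j)"
| "delta0 (EqF i j)"
| "delta0 BotF"
| "delta0 \<phi> \<Longrightarrow> delta0 \<psi> \<Longrightarrow> delta0 (ImpF \<phi> \<psi>)"
| "delta0 \<phi> \<Longrightarrow> delta0 (AllF (ImpF (MemF 0 (Suc i)) \<phi>))"
| "delta0 \<phi> \<Longrightarrow> delta0 (ExF (AndF (MemF 0 (Suc i)) \<phi>))"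


section \<open>Higher-order notation for formulas\<close>

text \<open>
  To write formulas with named variables, we use functions \<open>nat \<Rightarrow> fm\<close> whose argument \<open>d\<close> is the
  number of enclosing quantifiers. A variable is denoted by its level, i.e. the number of
  quantifiers enclosing its binder; at depth \<open>d\<close>, level \<open>x\<close> is the de Bruijn index \<open>d - Suc x\<close>.
  A sentence is obtained by applying such a function to \<open>0\<close>.
\<close>

type_synonym fml = "nat \<Rightarrow> fm"

definition mem :: "nat \<Rightarrow> nat \<Rightarrow> fml" (infix \<open>\<^bold>\<in>\<close> 50) where
  "(x \<^bold>\<in> y) = (\<lambda>d. MemF (d - Suc x) (d - Suc y))"

definition eq :: "nat \<Rightarrow> nat \<Rightarrow> fml" (infix \<open>\<^bold>=\<close> 50) where
  "(x \<^bold>= y) = (\<lambda>d. EqF (d - Suc x) (d - Suc y))"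

definition bot :: fml (\<open>\<^bold>\<bottom>\<close>) where
  "\<^bold>\<bottom> = (\<lambda>d. BotF)"

definition neg :: "fml \<Rightarrow> fml" (\<open>\<^bold>\<not> _\<close> [40] 40) where
  "(\<^bold>\<not> p) = (\<lambda>d. NegF (p d))"

definition conj :: "fml \<Rightarrow> fml \<Rightarrow> fml" (infixr \<open>\<^bold>\<and>\<close> 35) where
  "(p \<^bold>\<and> q) = (\<lambda>d. AndF (p d) (q d))"

definition disj :: "fml \<Rightarrow> fml \<Rightarrow> fml" (infixr \<open>\<^bold>\<or>\<close> 30) where
  "(p \<^bold>\<or> q) = (\<lambda>d. OrF (p d) (q d))"

definition imp :: "fml \<Rightarrow> fml \<Rightarrow> fml" (infixr \<open>\<^bold>\<longrightarrow>\<close> 25) where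
  "(p \<^bold>\<longrightarrow> q) = (\<lambda>d. ImpF (p d) (q d))"

definition iff :: "fml \<Rightarrow> fml \<Rightarrow> fml" (infixr \<open>\<^bold>\<longleftrightarrow>\<close> 25) where
  "(p \<^bold>\<longleftrightarrow> q) = (\<lambda>d. IffF (p d) (q d))"

definition all :: "(nat \<Rightarrow> fml) \<Rightarrow> fml" (binder \<open>\<^bold>\<forall>\<close> 10) where
  "all p = (\<lambda>d. AllF (p d (Suc d)))"

definition ex :: "(nat \<Rightarrow> fml) \<Rightarrow> fml" (binder \<open>\<^bold>\<exists>\<close> 10) where
  "ex p = (\<lambda>d. ExF (p d (Suc d)))"

text \<open>
  Schemes. A formula \<open>\<phi>\<close> is used as \<open>\<phi>(x, p\<^sub>0, p\<^sub>1, \<dots>)\<close> or \<open>\<phi>(x, y, p\<^sub>0, p\<^sub>1, \<dots>)\<close>: its first one or two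
  variables are plugged with the given levels, and the next ones are parameters, which
  have the levels \<open>0, 1, \<dots>\<close> and are universally quantified by \<open>close k\<close>, where \<open>k\<close> is
  their number.
\<close>

definition app1 :: "fm \<Rightarrow> nat \<Rightarrow> fml" where
  "app1 \<phi> x = (\<lambda>d. ren (\<lambda>i. d - Suc (case_nat x id i)) \<phi>)"

definition app2 :: "fm \<Rightarrow> nat \<Rightarrow> nat \<Rightarrow> fml" where
  "app2 \<phi> x y = (\<lambda>d. ren (\<lambda>i. d - Suc (case_nat x (case_nat y id) i)) \<phi>)"

definition close :: "nat \<Rightarrow> fml \<Rightarrow> fm" where
  "close k p = (AllF ^^ k) (p k)"


section \<open>Basic set-theoretic notions\<close>

definition is_subset :: "nat \<Rightarrow> nat \<Rightarrow> fml" (infix \<open>\<^bold>\<subseteq>\<close> 50) where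
  "(x \<^bold>\<subseteq> y) = (\<^bold>\<forall>z. z \<^bold>\<in> x \<^bold>\<longrightarrow> z \<^bold>\<in> y)"

definition is_empty :: "nat \<Rightarrow> fml" where
  "is_empty x = (\<^bold>\<forall>y. \<^bold>\<not> y \<^bold>\<in> x)"

definition is_upair :: "nat \<Rightarrow> nat \<Rightarrow> nat \<Rightarrow> fml" where \<comment> \<open>\<open>z = {x, y}\<close>\<close>
  "is_upair x y z = (\<^bold>\<forall>w. w \<^bold>\<in> z \<^bold>\<longleftrightarrow> w \<^bold>= x \<^bold>\<or> w \<^bold>= y)"

definition is_pair :: "nat \<Rightarrow> nat \<Rightarrow> nat \<Rightarrow> fml" where \<comment> \<open>\<open>z = \<langle>x, y\<rangle>\<close>\<close>
  "is_pair x y z = (\<^bold>\<exists>u v. is_upair x x u \<^bold>\<and> is_upair x y v \<^bold>\<and> is_upair u v z)"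

definition pair_in :: "nat \<Rightarrow> nat \<Rightarrow> nat \<Rightarrow> fml" where \<comment> \<open>\<open>\<langle>x, y\<rangle> \<in> f\<close>; for a function \<open>f\<close>: \<open>f(x) = y\<close>\<close>
  "pair_in x y f = (\<^bold>\<exists>p. is_pair x y p \<^bold>\<and> p \<^bold>\<in> f)"

definition is_succ :: "nat \<Rightarrow> nat \<Rightarrow> fml" where \<comment> \<open>\<open>z = x \<union> {x}\<close>\<close>
  "is_succ x z = (\<^bold>\<forall>w. w \<^bold>\<in> z \<^bold>\<longleftrightarrow> w \<^bold>\<in> x \<^bold>\<or> w \<^bold>= x)"

definition is_transitive :: "nat \<Rightarrow> fml" where
  "is_transitive y = (\<^bold>\<forall>x. x \<^bold>\<in> y \<^bold>\<longrightarrow> x \<^bold>\<subseteq> y)"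

definition is_function :: "nat \<Rightarrow> nat \<Rightarrow> fml" where \<comment> \<open>\<open>f\<close> is a function with domain \<open>A\<close>\<close>
  "is_function f A =
    ((\<^bold>\<forall>p. p \<^bold>\<in> f \<^bold>\<longrightarrow> (\<^bold>\<exists>x y. x \<^bold>\<in> A \<^bold>\<and> is_pair x y p)) \<^bold>\<and>
     (\<^bold>\<forall>x. x \<^bold>\<in> A \<^bold>\<longrightarrow> (\<^bold>\<exists>y. pair_in x y f \<^bold>\<and> (\<^bold>\<forall>z. pair_in x z f \<^bold>\<longrightarrow> z \<^bold>= y))))"

definition maps :: "nat \<Rightarrow> nat \<Rightarrow> nat \<Rightarrow> fml" where \<comment> \<open>\<open>f : A \<rightarrow> B\<close>\<close>
  "maps f A B = (is_function f A \<^bold>\<and> (\<^bold>\<forall>x y. pair_in x y f \<^bold>\<longrightarrow> y \<^bold>\<in> B))"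

definition is_bijection :: "nat \<Rightarrow> nat \<Rightarrow> nat \<Rightarrow> fml" where
  "is_bijection f A B =
    (maps f A B \<^bold>\<and> (\<^bold>\<forall>y. y \<^bold>\<in> B \<^bold>\<longrightarrow> (\<^bold>\<exists>x. pair_in x y f \<^bold>\<and> (\<^bold>\<forall>z. pair_in z y f \<^bold>\<longrightarrow> z \<^bold>= x))))"

definition is_comp :: "nat \<Rightarrow> nat \<Rightarrow> nat \<Rightarrow> fml" where
  \<comment> \<open>\<open>h = g \<circ> f\<close> for functions \<open>f\<close>, \<open>g\<close> with the range of \<open>f\<close> contained in the domain of \<open>g\<close>\<close>
  "is_comp f g h = (\<^bold>\<exists>A. is_function f A \<^bold>\<and> is_function h A \<^bold>\<and>
     (\<^bold>\<forall>x y z. pair_in x y f \<^bold>\<and> pair_in y z g \<^bold>\<longrightarrow> pair_in x z h))"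

definition is_inductive :: "nat \<Rightarrow> fml" where
  "is_inductive w = ((\<^bold>\<exists>e. is_empty e \<^bold>\<and> e \<^bold>\<in> w) \<^bold>\<and> (\<^bold>\<forall>x. x \<^bold>\<in> w \<^bold>\<longrightarrow> (\<^bold>\<exists>s. is_succ x s \<^bold>\<and> s \<^bold>\<in> w)))"

definition is_omega :: "nat \<Rightarrow> fml" where
  "is_omega w = (is_inductive w \<^bold>\<and> (\<^bold>\<forall>z. is_inductive z \<^bold>\<longrightarrow> w \<^bold>\<subseteq> z))"

definition is_natural :: "nat \<Rightarrow> fml" where
  "is_natural n = (\<^bold>\<exists>w. is_omega w \<^bold>\<and> n \<^bold>\<in> w)"

definition is_infinite :: "nat \<Rightarrow> fml" where
  "is_infinite A = (\<^bold>\<not> (\<^bold>\<exists>n f. is_natural n \<^bold>\<and> is_bijection f n A))"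

primrec is_num :: "nat \<Rightarrow> nat \<Rightarrow> fml" where \<comment> \<open>\<open>z\<close> is the von Neumann numeral of the meta-level number\<close>
  "is_num 0 z = is_empty z"
| "is_num (Suc k) z = (\<^bold>\<exists>u. is_num k u \<^bold>\<and> is_succ u z)"

definition is_seq2 :: "nat \<Rightarrow> nat \<Rightarrow> nat \<Rightarrow> fml" where \<comment> \<open>\<open>w\<close> is the sequence of length 2 with entries \<open>x\<close>, \<open>y\<close>\<close>
  "is_seq2 x y w = (\<^bold>\<exists>a b p q. is_num 0 a \<^bold>\<and> is_num 1 b \<^bold>\<and> is_pair a x p \<^bold>\<and> is_pair b y q \<^bold>\<and> is_upair p q w)"


section \<open>First-order languages, structures and satisfaction inside set theory\<close>

text \<open>
  A first-order language is a pair \<open>L = \<langle>R, F\<rangle>\<close> of functions that assign to the relation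
  symbols and to the function symbols their arities (constants are function symbols of arity 0).
  An \<open>L\<close>-structure is \<open>\<langle>M, \<langle>P, G\<rangle>\<rangle>\<close> with \<open>M\<close> nonempty, \<open>P(r) \<subseteq> M\<^sup>n\<close> for each relation symbol \<open>r\<close> of
  arity \<open>n\<close>, and \<open>G(f) : M\<^sup>n \<rightarrow> M\<close> for each function symbol \<open>f\<close> of arity \<open>n\<close>, where \<open>M\<^sup>n\<close> is the set
  of functions from the natural number \<open>n\<close> to \<open>M\<close>.
\<close>

definition is_arity :: "nat \<Rightarrow> fml" where
  "is_arity R = (\<^bold>\<exists>D w. is_omega w \<^bold>\<and> maps R D w)"

definition is_language :: "nat \<Rightarrow> fml" where
  "is_language L = (\<^bold>\<exists>R F. is_pair R F L \<^bold>\<and> is_arity R \<^bold>\<and> is_arity F)"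

definition is_power :: "nat \<Rightarrow> nat \<Rightarrow> nat \<Rightarrow> fml" where \<comment> \<open>\<open>D = M\<^sup>n\<close>\<close>
  "is_power M n D = (\<^bold>\<forall>s. s \<^bold>\<in> D \<^bold>\<longleftrightarrow> maps s n M)"

definition is_structure :: "nat \<Rightarrow> nat \<Rightarrow> fml" where
  "is_structure L A = (\<^bold>\<exists>R F M I P G.
     is_pair R F L \<^bold>\<and> is_pair M I A \<^bold>\<and> is_pair P G I \<^bold>\<and> (\<^bold>\<exists>x. x \<^bold>\<in> M) \<^bold>\<and>
     (\<^bold>\<exists>D. is_function R D \<^bold>\<and> is_function P D) \<^bold>\<and>
     (\<^bold>\<forall>r n p. pair_in r n R \<^bold>\<and> pair_in r p P \<^bold>\<longrightarrow> (\<^bold>\<forall>s. s \<^bold>\<in> p \<^bold>\<longrightarrow> maps s n M)) \<^bold>\<and>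
     (\<^bold>\<exists>D. is_function F D \<^bold>\<and> is_function G D) \<^bold>\<and>
     (\<^bold>\<forall>f n g. pair_in f n F \<^bold>\<and> pair_in f g G \<^bold>\<longrightarrow> (\<^bold>\<exists>D. is_power M n D \<^bold>\<and> maps g D M)))"

text \<open>
  Coding of syntax. The variables are the elements \<open>i\<close> of \<open>\<omega>\<close>. Terms and formulas are coded by
  \<open>v\<^sub>i = \<langle>0, i\<rangle>\<close>, \<open>f(w) = \<langle>1, \<langle>f, w\<rangle>\<rangle>\<close>, \<open>(t = u) = \<langle>2, \<langle>t, u\<rangle>\<rangle>\<close>, \<open>r(w) = \<langle>3, \<langle>r, w\<rangle>\<rangle>\<close>, \<open>\<bottom> = \<langle>4, 0\<rangle>\<close>,
  \<open>(p \<longrightarrow> q) = \<langle>5, \<langle>p, q\<rangle>\<rangle>\<close>, \<open>(\<forall>v\<^sub>i. p) = \<langle>6, \<langle>i, p\<rangle>\<rangle>\<close>, where \<open>w\<close> is a sequence of terms.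
\<close>

definition tagged :: "nat \<Rightarrow> nat \<Rightarrow> nat \<Rightarrow> fml" where
  "tagged k x z = (\<^bold>\<exists>t. is_num k t \<^bold>\<and> is_pair t x z)"

definition tagged2 :: "nat \<Rightarrow> nat \<Rightarrow> nat \<Rightarrow> nat \<Rightarrow> fml" where
  "tagged2 k x y z = (\<^bold>\<exists>p. is_pair x y p \<^bold>\<and> tagged k p z)"

definition var_code :: "nat \<Rightarrow> nat \<Rightarrow> fml" where "var_code = tagged 0"
definition fun_code :: "nat \<Rightarrow> nat \<Rightarrow> nat \<Rightarrow> fml" where "fun_code = tagged2 1"
definition eq_code :: "nat \<Rightarrow> nat \<Rightarrow> nat \<Rightarrow> fml" where "eq_code = tagged2 2"
definition rel_code :: "nat \<Rightarrow> nat \<Rightarrow> nat \<Rightarrow> fml" where "rel_code = tagged2 3"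
definition bot_code :: "nat \<Rightarrow> fml" where "bot_code z = (\<^bold>\<exists>e. is_empty e \<^bold>\<and> tagged 4 e z)"
definition imp_code :: "nat \<Rightarrow> nat \<Rightarrow> nat \<Rightarrow> fml" where "imp_code = tagged2 5"
definition all_code :: "nat \<Rightarrow> nat \<Rightarrow> nat \<Rightarrow> fml" where "all_code = tagged2 6"

text \<open>
  Terms and formulas are the entries of finite formation sequences. \<open>V\<close> is the set of variables
  that are allowed to occur (free or bound).
\<close>

definition earlier :: "nat \<Rightarrow> nat \<Rightarrow> nat \<Rightarrow> fml" where \<comment> \<open>\<open>t = c(j)\<close> for some \<open>j < k\<close>\<close>
  "earlier c k t = (\<^bold>\<exists>j. j \<^bold>\<in> k \<^bold>\<and> pair_in j t c)"

definition entry :: "nat \<Rightarrow> nat \<Rightarrow> fml" where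
  "entry c t = (\<^bold>\<exists>j. pair_in j t c)"

definition term_seq :: "nat \<Rightarrow> nat \<Rightarrow> nat \<Rightarrow> fml" where
  "term_seq L V c = (\<^bold>\<exists>R F n. is_pair R F L \<^bold>\<and> is_natural n \<^bold>\<and> is_function c n \<^bold>\<and>
     (\<^bold>\<forall>k t. pair_in k t c \<^bold>\<longrightarrow>
        (\<^bold>\<exists>i. i \<^bold>\<in> V \<^bold>\<and> var_code i t) \<^bold>\<or>
        (\<^bold>\<exists>f m w. pair_in f m F \<^bold>\<and> is_function w m \<^bold>\<and> (\<^bold>\<forall>l u. pair_in l u w \<^bold>\<longrightarrow> earlier c k u) \<^bold>\<and>
           fun_code f w t)))"

definition is_term :: "nat \<Rightarrow> nat \<Rightarrow> nat \<Rightarrow> fml" where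
  "is_term L V t = (\<^bold>\<exists>c. term_seq L V c \<^bold>\<and> entry c t)"

definition formula_seq :: "nat \<Rightarrow> nat \<Rightarrow> nat \<Rightarrow> fml" where
  "formula_seq L V c = (\<^bold>\<exists>R F n. is_pair R F L \<^bold>\<and> is_natural n \<^bold>\<and> is_function c n \<^bold>\<and>
     (\<^bold>\<forall>k \<phi>. pair_in k \<phi> c \<^bold>\<longrightarrow>
        (\<^bold>\<exists>t u. is_term L V t \<^bold>\<and> is_term L V u \<^bold>\<and> eq_code t u \<phi>) \<^bold>\<or>
        (\<^bold>\<exists>r m w. pair_in r m R \<^bold>\<and> is_function w m \<^bold>\<and> (\<^bold>\<forall>l t. pair_in l t w \<^bold>\<longrightarrow> is_term L V t) \<^bold>\<and>
           rel_code r w \<phi>) \<^bold>\<or>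
        bot_code \<phi> \<^bold>\<or>
        (\<^bold>\<exists>p q. earlier c k p \<^bold>\<and> earlier c k q \<^bold>\<and> imp_code p q \<phi>) \<^bold>\<or>
        (\<^bold>\<exists>i p. i \<^bold>\<in> V \<^bold>\<and> earlier c k p \<^bold>\<and> all_code i p \<phi>)))"

definition is_formula :: "nat \<Rightarrow> nat \<Rightarrow> nat \<Rightarrow> fml" where
  "is_formula L V \<phi> = (\<^bold>\<exists>c. formula_seq L V c \<^bold>\<and> entry c \<phi>)"

text \<open>
  The term \<open>t\<close> has the value \<open>a\<close> in the structure \<open>A\<close> under the assignment \<open>s : V \<rightarrow> M\<close>. The function
  \<open>e\<close> evaluates all the entries of a formation sequence of \<open>t\<close>.
\<close>

definition has_value :: "nat \<Rightarrow> nat \<Rightarrow> nat \<Rightarrow> nat \<Rightarrow> nat \<Rightarrow> nat \<Rightarrow> fml" where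
  "has_value L A V s t a = (\<^bold>\<exists>M I P G c D e.
     is_pair M I A \<^bold>\<and> is_pair P G I \<^bold>\<and> term_seq L V c \<^bold>\<and> entry c t \<^bold>\<and>
     (\<^bold>\<forall>u. u \<^bold>\<in> D \<^bold>\<longleftrightarrow> entry c u) \<^bold>\<and> maps e D M \<^bold>\<and>
     (\<^bold>\<forall>u b. pair_in u b e \<^bold>\<longrightarrow>
        (\<^bold>\<exists>i. var_code i u \<^bold>\<and> pair_in i b s) \<^bold>\<or>
        (\<^bold>\<exists>f w g x. fun_code f w u \<^bold>\<and> pair_in f g G \<^bold>\<and> is_comp w e x \<^bold>\<and> pair_in x b g)) \<^bold>\<and>
     pair_in t a e)"

definition have_values :: "nat \<Rightarrow> nat \<Rightarrow> nat \<Rightarrow> nat \<Rightarrow> nat \<Rightarrow> nat \<Rightarrow> fml" where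
  \<comment> \<open>\<open>x\<close> is the sequence of the values of the sequence \<open>w\<close> of terms\<close>
  "have_values L A V s w x = (\<^bold>\<exists>m. is_function w m \<^bold>\<and> is_function x m \<^bold>\<and>
     (\<^bold>\<forall>l t a. pair_in l t w \<^bold>\<and> pair_in l a x \<^bold>\<longrightarrow> has_value L A V s t a))"

definition variant :: "nat \<Rightarrow> nat \<Rightarrow> nat \<Rightarrow> nat \<Rightarrow> nat \<Rightarrow> fml" where
  \<comment> \<open>\<open>s, s' : V \<rightarrow> M\<close> differ at most at \<open>i\<close>\<close>
  "variant V M i s s' = (maps s V M \<^bold>\<and> maps s' V M \<^bold>\<and>
     (\<^bold>\<forall>j a. j \<^bold>\<in> V \<^bold>\<and> \<^bold>\<not> j \<^bold>= i \<^bold>\<longrightarrow> (pair_in j a s \<^bold>\<longleftrightarrow> pair_in j a s')))"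

text \<open>
  \<open>S\<close> is a satisfaction relation for the entries of the formation sequence \<open>c\<close> and for the assignments
  \<open>V \<rightarrow> M\<close> in \<open>A\<close>: it obeys Tarski's clauses.
\<close>

definition sat_relation :: "nat \<Rightarrow> nat \<Rightarrow> nat \<Rightarrow> nat \<Rightarrow> nat \<Rightarrow> fml" where
  "sat_relation L A V c S = (\<^bold>\<exists>M I P G. is_pair M I A \<^bold>\<and> is_pair P G I \<^bold>\<and>
     (\<^bold>\<forall>\<phi> s. entry c \<phi> \<^bold>\<and> maps s V M \<^bold>\<longrightarrow>
       (pair_in \<phi> s S \<^bold>\<longleftrightarrow>
        (\<^bold>\<exists>t u a. eq_code t u \<phi> \<^bold>\<and> has_value L A V s t a \<^bold>\<and> has_value L A V s u a) \<^bold>\<or>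
        (\<^bold>\<exists>r w p x. rel_code r w \<phi> \<^bold>\<and> pair_in r p P \<^bold>\<and> have_values L A V s w x \<^bold>\<and> x \<^bold>\<in> p) \<^bold>\<or>
        (\<^bold>\<exists>p q. imp_code p q \<phi> \<^bold>\<and> (pair_in p s S \<^bold>\<longrightarrow> pair_in q s S)) \<^bold>\<or>
        (\<^bold>\<exists>i p. all_code i p \<phi> \<^bold>\<and> (\<^bold>\<forall>s'. variant V M i s s' \<^bold>\<longrightarrow> pair_in p s' S)))))"

text \<open>
  \<open>A \<Turnstile> \<phi>[s]\<close>. The assignment \<open>s\<close> is a finite sequence whose length \<open>V\<close> is a natural number, such that all
  variables of \<open>\<phi>\<close>, free or bound, are elements of \<open>V = {0, \<dots>, V - 1}\<close>.
\<close>

definition sat :: "nat \<Rightarrow> nat \<Rightarrow> nat \<Rightarrow> nat \<Rightarrow> fml" where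
  "sat L A s \<phi> = (\<^bold>\<exists>V M I c S. is_natural V \<^bold>\<and> is_pair M I A \<^bold>\<and> maps s V M \<^bold>\<and>
     formula_seq L V c \<^bold>\<and> entry c \<phi> \<^bold>\<and> sat_relation L A V c S \<^bold>\<and> pair_in \<phi> s S)"

text \<open>\<open>A \<Turnstile> \<phi>\<close>; a formula with free variables is read as its universal closure.\<close>

definition models :: "nat \<Rightarrow> nat \<Rightarrow> nat \<Rightarrow> fml" where
  "models L A \<phi> = (\<^bold>\<exists>V M I. is_natural V \<^bold>\<and> is_pair M I A \<^bold>\<and> is_formula L V \<phi> \<^bold>\<and>
     (\<^bold>\<forall>s. maps s V M \<^bold>\<longrightarrow> sat L A s \<phi>))"

definition is_elementary_embedding :: "nat \<Rightarrow> nat \<Rightarrow> nat \<Rightarrow> nat \<Rightarrow> fml" where \<comment> \<open>\<open>j : A \<rightarrow> B\<close>\<close>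
  "is_elementary_embedding L A B j = (\<^bold>\<exists>M I N J. is_pair M I A \<^bold>\<and> is_pair N J B \<^bold>\<and> maps j M N \<^bold>\<and>
     (\<^bold>\<forall>V \<phi> s s'. is_natural V \<^bold>\<and> is_formula L V \<phi> \<^bold>\<and> maps s V M \<^bold>\<and> is_comp s j s' \<^bold>\<longrightarrow>
        (sat L A s \<phi> \<^bold>\<longleftrightarrow> sat L B s' \<phi>)))"


section \<open>The axioms of ZFC and BST\<close>

definition extensionality_ax :: fml where
  "extensionality_ax = (\<^bold>\<forall>x y. (\<^bold>\<forall>z. z \<^bold>\<in> x \<^bold>\<longleftrightarrow> z \<^bold>\<in> y) \<^bold>\<longrightarrow> x \<^bold>= y)"

definition empty_set_ax :: fml where
  "empty_set_ax = (\<^bold>\<exists>x. is_empty x)"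

definition pair_ax :: fml where
  "pair_ax = (\<^bold>\<forall>x y. \<^bold>\<exists>z. is_upair x y z)"

definition union_ax :: fml where
  "union_ax = (\<^bold>\<forall>x. \<^bold>\<exists>z. \<^bold>\<forall>w. w \<^bold>\<in> z \<^bold>\<longleftrightarrow> (\<^bold>\<exists>y. y \<^bold>\<in> x \<^bold>\<and> w \<^bold>\<in> y))"

definition cartesian_product_ax :: fml where
  "cartesian_product_ax =
    (\<^bold>\<forall>x y. \<^bold>\<exists>z. \<^bold>\<forall>p. p \<^bold>\<in> z \<^bold>\<longleftrightarrow> (\<^bold>\<exists>a b. a \<^bold>\<in> x \<^bold>\<and> b \<^bold>\<in> y \<^bold>\<and> is_pair a b p))"

definition omega_ax :: fml where
  "omega_ax = (\<^bold>\<exists>w. is_omega w)"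

definition power_set_ax :: fml where
  "power_set_ax = (\<^bold>\<forall>x. \<^bold>\<exists>z. \<^bold>\<forall>w. w \<^bold>\<in> z \<^bold>\<longleftrightarrow> w \<^bold>\<subseteq> x)"

definition infinity_ax :: fml where
  "infinity_ax = (\<^bold>\<exists>w. is_inductive w)"

definition foundation_ax :: fml where
  "foundation_ax = (\<^bold>\<forall>x. (\<^bold>\<exists>y. y \<^bold>\<in> x) \<^bold>\<longrightarrow> (\<^bold>\<exists>y. y \<^bold>\<in> x \<^bold>\<and> \<^bold>\<not> (\<^bold>\<exists>z. z \<^bold>\<in> x \<^bold>\<and> z \<^bold>\<in> y)))"

definition choice_ax :: fml where
  "choice_ax = (\<^bold>\<forall>x. (\<^bold>\<forall>y. y \<^bold>\<in> x \<^bold>\<longrightarrow> (\<^bold>\<exists>z. z \<^bold>\<in> y)) \<^bold>\<longrightarrow>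
     (\<^bold>\<exists>f. is_function f x \<^bold>\<and> (\<^bold>\<forall>y z. pair_in y z f \<^bold>\<longrightarrow> z \<^bold>\<in> y)))"

definition separation_ax :: "fm \<Rightarrow> nat \<Rightarrow> fm" where
  "separation_ax \<phi> k = close k (\<^bold>\<forall>a. \<^bold>\<exists>b. \<^bold>\<forall>x. x \<^bold>\<in> b \<^bold>\<longleftrightarrow> x \<^bold>\<in> a \<^bold>\<and> app1 \<phi> x)"

text \<open>
  The premise of Replacement says that for each \<open>x\<close> there is at most one \<open>y\<close> with \<open>\<phi>(x, y)\<close>.
\<close>

definition replacement_ax :: "fm \<Rightarrow> nat \<Rightarrow> fm" where
  "replacement_ax \<phi> k = close k
    ((\<^bold>\<forall>x. \<^bold>\<exists>u. \<^bold>\<forall>y. app2 \<phi> x y \<^bold>\<longrightarrow> y \<^bold>= u) \<^bold>\<longrightarrow>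
     (\<^bold>\<forall>a. \<^bold>\<exists>b. \<^bold>\<forall>y. y \<^bold>\<in> b \<^bold>\<longleftrightarrow> (\<^bold>\<exists>x. x \<^bold>\<in> a \<^bold>\<and> app2 \<phi> x y)))"

definition zfc_single_axioms :: "fml list" where
  "zfc_single_axioms = [extensionality_ax, foundation_ax, pair_ax, union_ax, power_set_ax,
     infinity_ax, choice_ax]"

definition ZFC :: "fm set" where
  "ZFC = (\<lambda>p. p 0) ` set zfc_single_axioms
     \<union> {separation_ax \<phi> k | \<phi> k. fv \<phi> \<subseteq> {..<k + 1}}
     \<union> {replacement_ax \<phi> k | \<phi> k. fv \<phi> \<subseteq> {..<k + 2}}"

definition BST :: "fm set" where
  "BST = (\<lambda>p. p 0) ` {empty_set_ax, extensionality_ax, pair_ax, union_ax, cartesian_product_ax, omega_ax}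
     \<union> {separation_ax \<phi> k | \<phi> k. delta0 \<phi> \<and> fv \<phi> \<subseteq> {..<k + 1}}"


section \<open>The axioms of ZFC inside set theory\<close>

text \<open>The language with a single binary relation symbol, \<open>0\<close>.\<close>

definition is_mem_language :: "nat \<Rightarrow> fml" where
  "is_mem_language L = (\<^bold>\<exists>R F zero two p. is_num 0 zero \<^bold>\<and> is_num 2 two \<^bold>\<and>
     is_pair zero two p \<^bold>\<and> is_upair p p R \<^bold>\<and> is_empty F \<^bold>\<and> is_pair R F L)"

text \<open>\<open>A\<close> is the structure \<open>(y, \<in>)\<close>.\<close>

definition is_mem_structure :: "nat \<Rightarrow> nat \<Rightarrow> fml" where
  "is_mem_structure y A = (\<^bold>\<exists>E zero p P G I.
     (\<^bold>\<forall>s. s \<^bold>\<in> E \<^bold>\<longleftrightarrow> (\<^bold>\<exists>a b. a \<^bold>\<in> y \<^bold>\<and> b \<^bold>\<in> y \<^bold>\<and> a \<^bold>\<in> b \<^bold>\<and> is_seq2 a b s)) \<^bold>\<and>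
     is_num 0 zero \<^bold>\<and> is_pair zero E p \<^bold>\<and> is_upair p p P \<^bold>\<and> is_empty G \<^bold>\<and>
     is_pair P G I \<^bold>\<and> is_pair y I A)"

text \<open>
  Codes of compound formulas are described by functions \<open>nat \<Rightarrow> fml\<close>, where \<open>c z\<close> says that \<open>z\<close> is
  the code. The arguments of type \<open>nat\<close> below are levels of variables that range over \<open>\<omega>\<close>
  (indices of coded variables).
\<close>

type_synonym code = "nat \<Rightarrow> fml"

definition cMem :: "nat \<Rightarrow> nat \<Rightarrow> code" where
  "cMem i j z = (\<^bold>\<exists>t u w r. var_code i t \<^bold>\<and> var_code j u \<^bold>\<and> is_seq2 t u w \<^bold>\<and> is_num 0 r \<^bold>\<and> rel_code r w z)"

definition cEq :: "nat \<Rightarrow> nat \<Rightarrow> code" where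
  "cEq i j z = (\<^bold>\<exists>t u. var_code i t \<^bold>\<and> var_code j u \<^bold>\<and> eq_code t u z)"

definition cImp :: "code \<Rightarrow> code \<Rightarrow> code" where
  "cImp c c' z = (\<^bold>\<exists>p q. c p \<^bold>\<and> c' q \<^bold>\<and> imp_code p q z)"

definition cAll :: "nat \<Rightarrow> code \<Rightarrow> code" where
  "cAll i c z = (\<^bold>\<exists>p. c p \<^bold>\<and> all_code i p z)"

definition cNeg :: "code \<Rightarrow> code" where "cNeg c = cImp c bot_code"
definition cAnd :: "code \<Rightarrow> code \<Rightarrow> code" where "cAnd c c' = cNeg (cImp c (cNeg c'))"
definition cIff :: "code \<Rightarrow> code \<Rightarrow> code" where "cIff c c' = cAnd (cImp c c') (cImp c' c)"
definition cEx :: "nat \<Rightarrow> code \<Rightarrow> code" where "cEx i c = cNeg (cAll i (cNeg c))"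

text \<open>
  \<open>quote k \<phi> z\<close>: \<open>z\<close> is the code of the meta-level formula \<open>\<phi>\<close> occurring under \<open>k\<close> quantifiers. The
  variable with level \<open>l\<close> is coded as \<open>v\<^sub>l\<close>.
\<close>

primrec quote :: "nat \<Rightarrow> fm \<Rightarrow> code" where
  "quote k (MemF i j) = (\<lambda>z. \<^bold>\<exists>a b. is_num (k - Suc i) a \<^bold>\<and> is_num (k - Suc j) b \<^bold>\<and> cMem a b z)"
| "quote k (EqF i j) = (\<lambda>z. \<^bold>\<exists>a b. is_num (k - Suc i) a \<^bold>\<and> is_num (k - Suc j) b \<^bold>\<and> cEq a b z)"
| "quote k BotF = bot_code"
| "quote k (ImpF \<phi> \<psi>) = cImp (quote k \<phi>) (quote k \<psi>)"
| "quote k (AllF \<phi>) = (\<lambda>z. \<^bold>\<exists>i. is_num k i \<^bold>\<and> cAll i (quote (Suc k) \<phi>) z)"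

fun distinct_variables :: "nat list \<Rightarrow> fml" where
  "distinct_variables [] = (\<^bold>\<not> \<^bold>\<bottom>)"
| "distinct_variables (i # is) =
    (is_natural i \<^bold>\<and> foldr (\<lambda>j p. \<^bold>\<not> i \<^bold>= j \<^bold>\<and> p) is (distinct_variables is))"

text \<open>\<open>\<phi>\<close> is a formula of the language of set theory in which the given variables do not occur.\<close>

definition formula_without :: "nat list \<Rightarrow> nat \<Rightarrow> fml" where
  "formula_without is \<phi> = (\<^bold>\<exists>L V. is_mem_language L \<^bold>\<and>
     (\<^bold>\<forall>j. j \<^bold>\<in> V \<^bold>\<longleftrightarrow> foldr (\<lambda>i p. \<^bold>\<not> j \<^bold>= i \<^bold>\<and> p) is (is_natural j)) \<^bold>\<and> is_formula L V \<phi>)"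

definition is_separation_axiom :: "nat \<Rightarrow> fml" where
  "is_separation_axiom z = (\<^bold>\<exists>a b x \<phi>. distinct_variables [a, b, x] \<^bold>\<and> formula_without [a, b] \<phi> \<^bold>\<and>
     cAll a (cEx b (cAll x (cIff (cMem x b) (cAnd (cMem x a) (eq \<phi>))))) z)"

definition is_replacement_axiom :: "nat \<Rightarrow> fml" where
  "is_replacement_axiom z = (\<^bold>\<exists>a b u x y \<phi>.
     distinct_variables [a, b, u, x, y] \<^bold>\<and> formula_without [a, b, u] \<phi> \<^bold>\<and>
     cImp (cAll x (cEx u (cAll y (cImp (eq \<phi>) (cEq y u)))))
       (cAll a (cEx b (cAll y (cIff (cMem y b) (cEx x (cAnd (cMem x a) (eq \<phi>))))))) z)"

definition is_zfc_axiom :: "nat \<Rightarrow> fml" where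
  "is_zfc_axiom z = foldr (\<lambda>p q. quote 0 (p 0) z \<^bold>\<or> q) zfc_single_axioms
     (is_separation_axiom z \<^bold>\<or> is_replacement_axiom z)"

definition models_zfc :: "nat \<Rightarrow> fml" where \<comment> \<open>\<open>(y, \<in>) \<Turnstile> ZFC\<close>\<close>
  "models_zfc y = (\<^bold>\<exists>L A. is_mem_language L \<^bold>\<and> is_mem_structure y A \<^bold>\<and>
     (\<^bold>\<forall>\<sigma>. is_zfc_axiom \<sigma> \<^bold>\<longrightarrow> models L A \<sigma>))"


section \<open>LZFC, V-P-H and Vopenka's Principle\<close>

definition Loc_ZFC :: fml where
  "Loc_ZFC = (\<^bold>\<forall>x. \<^bold>\<exists>y. x \<^bold>\<in> y \<^bold>\<and> is_transitive y \<^bold>\<and> models_zfc y)"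

definition LZFC :: "fm set" where
  "LZFC = BST \<union> {Loc_ZFC 0}"

definition is_endomorphism :: "nat \<Rightarrow> nat \<Rightarrow> nat \<Rightarrow> fml" where
  "is_endomorphism A R f = (maps f A A \<^bold>\<and>
     (\<^bold>\<forall>x y x' y'. x \<^bold>\<in> A \<^bold>\<and> y \<^bold>\<in> A \<^bold>\<and> pair_in x y R \<^bold>\<and> pair_in x x' f \<^bold>\<and> pair_in y y' f \<^bold>\<longrightarrow> pair_in x' y' R))"

definition is_rigid :: "nat \<Rightarrow> nat \<Rightarrow> fml" where
  "is_rigid A R = (\<^bold>\<forall>f. is_endomorphism A R f \<^bold>\<longrightarrow> (\<^bold>\<forall>x. x \<^bold>\<in> A \<^bold>\<longrightarrow> pair_in x x f))"

definition VPH :: fm where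
  "VPH = (\<^bold>\<forall>A. is_infinite A \<^bold>\<longrightarrow> (\<^bold>\<exists>R.
     (\<^bold>\<forall>p. p \<^bold>\<in> R \<^bold>\<longrightarrow> (\<^bold>\<exists>x y. x \<^bold>\<in> A \<^bold>\<and> y \<^bold>\<in> A \<^bold>\<and> is_pair x y p)) \<^bold>\<and> is_rigid A R)) 0"

definition vp_ax :: "fm \<Rightarrow> nat \<Rightarrow> fm" where
  "vp_ax \<phi> k = close k (\<^bold>\<forall>L. is_language L \<^bold>\<and> (\<^bold>\<forall>x. app1 \<phi> x \<^bold>\<longrightarrow> is_structure L x) \<^bold>\<and>
     \<^bold>\<not> (\<^bold>\<exists>z. \<^bold>\<forall>x. x \<^bold>\<in> z \<^bold>\<longleftrightarrow> app1 \<phi> x) \<^bold>\<longrightarrow>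
     (\<^bold>\<exists>x y j. app1 \<phi> x \<^bold>\<and> app1 \<phi> y \<^bold>\<and> \<^bold>\<not> x \<^bold>= y \<^bold>\<and> is_elementary_embedding L x y j))"

definition VP :: "fm set" where
  "VP = {vp_ax \<phi> k | \<phi> k. fv \<phi> \<subseteq> {..<k + 1}}"

end

theory Submission
  imports Defs "HOL-Library.Countable" "HOL-Library.Infinite_Set"
begin

text \<open>
  By soundness and completeness it suffices to verify the axioms of ZFC in each model of \<open>T + VP\<close>.

  Foundation and Choice follow from \<open>Loc(ZFC)\<close>: a given set belongs to a transitive set that is a
  model of ZFC in the internal sense, internal satisfaction of a standard formula agrees with its
  relativization, and the instances of the two axioms are absolute.

  Replacement (hence Separation) and Power set follow from Vopenka's Principle. Let a class assign to
  certain subsets \<open>B\<close> of a set \<open>A\<close> one value \<open>y\<close> each. Code the pair \<open>(B, y)\<close> by a structure with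
  universe \<open>{y}\<close> in the language with one propositional variable for each \<open>a \<in> A\<close>, which is true iff
  \<open>a \<in> B\<close>. An elementary embedding between two of these structures forces equality of the sets \<open>B\<close>, hence of
  the structures, so by VP the structures form a set, and so do the values. With \<open>B = {x}\<close> this is
  Replacement, with \<open>y = B\<close> it is Power set.
\<close>

text \<open>\<open>BST\<close> has no Foundation and only bounded Separation, and its \<omega> may
  be nonstandard, so no general theory of satisfaction is built inside the model. Two special cases
  carry the proof. For Vopenka's Principle only propositional variables are evaluated: a formation
  sequence with one entry, the empty assignment (which every embedding sends to itself), and an
  explicit satisfaction relation with one element. For \<open>Loc_ZFC\<close> only codes of actual
  formulas occur, so that the agreement of satisfaction with truth is an induction on the formula
  outside the model.

  Replacement is the goal, so the values y cannot be read off the set X of structures by taking an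
  image. Kuratowski pairs help: {{y}} is an element of every structure with universe {y}, hence y
  lies in the third union of X, and "{{y}} is in the union of X" is a bounded condition that cuts
  out exactly the values.

  The hypothesis on T compares theorems, which are sentences by definition. Everything taken from
  LZFC must therefore be a sentence.\<close>

instance fm :: countable
  by countable_datatype

section \<open>Renaming\<close>

lemma case_nat_comp: "case_nat (f a) (f \<circ> g) = f \<circ> case_nat a g"
  by (auto split: nat.split)

lemma lift_comp: "case_nat 0 (Suc \<circ> \<rho>) \<circ> case_nat 0 (Suc \<circ> \<tau>) = case_nat 0 (Suc \<circ> (\<rho> \<circ> \<tau>))"
  by (auto split: nat.split)

lemma inst_lift: "case_nat t id \<circ> case_nat 0 (Suc \<circ> \<rho>) = case_nat t \<rho>"
  by (auto split: nat.split)

lemma ren_ren: "ren \<rho> (ren \<tau> \<phi>) = ren (\<rho> \<circ> \<tau>) \<phi>"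
  by (induction \<phi> arbitrary: \<rho> \<tau>) (simp_all add: lift_comp)

lemma ren_cong: "(\<And>i. i \<in> fv \<phi> \<Longrightarrow> \<rho> i = \<tau> i) \<Longrightarrow> ren \<rho> \<phi> = ren \<tau> \<phi>"
proof (induction \<phi> arbitrary: \<rho> \<tau>)
  case (AllF \<phi>)
  have "ren (case_nat 0 (Suc \<circ> \<rho>)) \<phi> = ren (case_nat 0 (Suc \<circ> \<tau>)) \<phi>"
    using AllF.prems by (intro AllF.IH) (auto split: nat.split)
  then show ?case by simp
next
  case (ImpF \<phi> \<psi>)
  have "ren \<rho> \<phi> = ren \<tau> \<phi>" "ren \<rho> \<psi> = ren \<tau> \<psi>"
    using ImpF.prems by (intro ImpF.IH; simp)+
  then show ?case by simp
qed simp_all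

lemma ren_ident: "(\<And>i. \<rho> i = i) \<Longrightarrow> ren \<rho> \<phi> = \<phi>"
proof (induction \<phi> arbitrary: \<rho>)
  case (AllF \<phi>)
  then have "ren (case_nat 0 (Suc \<circ> \<rho>)) \<phi> = \<phi>"
    by (intro AllF.IH) (simp split: nat.split)
  then show ?case by simp
qed simp_all

lemma fv_ren: "fv (ren \<rho> \<phi>) = \<rho> ` fv \<phi>"
proof (induction \<phi> arbitrary: \<rho>)
  case (AllF \<phi>)
  have "fv (ren \<rho> (AllF \<phi>)) = {i. Suc i \<in> case_nat 0 (Suc \<circ> \<rho>) ` fv \<phi>}"
    by (simp add: AllF.IH)
  also have "\<dots> = \<rho> ` {i. Suc i \<in> fv \<phi>}"
  proof (intro set_eqI iffI)
    fix i
    assume "i \<in> {i. Suc i \<in> case_nat 0 (Suc \<circ> \<rho>) ` fv \<phi>}"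
    then obtain j where "j \<in> fv \<phi>" "Suc i = case_nat 0 (Suc \<circ> \<rho>) j" by auto
    then show "i \<in> \<rho> ` {i. Suc i \<in> fv \<phi>}" by (cases j) auto
  next
    fix i
    assume "i \<in> \<rho> ` {i. Suc i \<in> fv \<phi>}"
    then obtain j where j: "Suc j \<in> fv \<phi>" "i = \<rho> j" by auto
    then have "Suc i = case_nat 0 (Suc \<circ> \<rho>) (Suc j)" by simp
    with j(1) show "i \<in> {i. Suc i \<in> case_nat 0 (Suc \<circ> \<rho>) ` fv \<phi>}" by blast
  qed
  finally show ?case by simp
qed auto

lemma finite_fv: "finite (fv \<phi>)"
proof (induction \<phi>)
  case (AllF \<phi>)
  have "fv (AllF \<phi>) = Suc -` fv \<phi>" by auto
  with AllF show ?case by (simp add: finite_vimageI)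
qed auto

lemma ren_inst: "ren \<rho> (inst \<phi> t) = inst (ren (case_nat 0 (Suc \<circ> \<rho>)) \<phi>) (\<rho> t)"
proof -
  have "\<rho> \<circ> case_nat t id = case_nat (\<rho> t) \<rho>" by (auto split: nat.split)
  then show ?thesis by (simp add: inst_def ren_ren inst_lift)
qed

section \<open>Structural properties of derivations\<close>

lemma proves_ren: "\<Gamma> \<turnstile> \<phi> \<Longrightarrow> ren \<rho> ` \<Gamma> \<turnstile> ren \<rho> \<phi>"
proof (induction arbitrary: \<rho> rule: proves.induct)
  case (Assm \<phi> \<Gamma>)
  then show ?case by (simp add: proves.Assm)
next
  case (ImpI \<phi> \<Gamma> \<psi>)
  then show ?case by (simp add: proves.ImpI)
next
  case (ImpE \<Gamma> \<phi> \<psi>)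
  then show ?case by (metis proves.ImpE ren.simps(4))
next
  case (Raa \<phi> \<Gamma>)
  then show ?case by (simp add: proves.Raa)
next
  case (AllI \<Gamma> \<phi>)
  \<comment> \<open>Lifting commutes with the shift, so the eigenvariable condition, which
    \<open>AllI\<close> expresses by shifting the context, survives the renaming.\<close>
  have "ren (case_nat 0 (Suc \<circ> \<rho>)) ` ren Suc ` \<Gamma> = ren Suc ` ren \<rho> ` \<Gamma>"
  proof -
    have "case_nat 0 (Suc \<circ> \<rho>) \<circ> Suc = Suc \<circ> \<rho>" by auto
    then show ?thesis by (simp add: image_image ren_ren)
  qed
  with AllI.IH[of "case_nat 0 (Suc \<circ> \<rho>)"] show ?case by (simp add: proves.AllI)
next
  case (AllE \<Gamma> \<phi> t)
  then show ?case by (simp add: ren_inst proves.AllE)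
next
  case (EqI \<Gamma> t)
  then show ?case by (simp add: proves.EqI)
next
  case (EqE \<Gamma> s t \<phi>)
  then show ?case by (metis proves.EqE ren.simps(2) ren_inst)
qed

lemma proves_mono: "\<Gamma> \<turnstile> \<phi> \<Longrightarrow> \<Gamma> \<subseteq> \<Delta> \<Longrightarrow> \<Delta> \<turnstile> \<phi>"
proof (induction arbitrary: \<Delta> rule: proves.induct)
  case (AllI \<Gamma> \<phi>)
  then show ?case by (simp add: image_mono proves.AllI)
next
  case (ImpI \<phi> \<Gamma> \<psi>)
  then show ?case by (meson insert_mono proves.ImpI)
next
  case (Raa \<phi> \<Gamma>)
  then show ?case by (meson insert_mono proves.Raa)
next
  case (EqE \<Gamma> s t \<phi>)
  then show ?case by (meson proves.EqE)
qed (auto intro: proves.intros)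

text \<open>A derivation uses finitely many assumptions. This is what makes the union of the Henkin
  chain consistent.\<close>

lemma proves_finite: "\<Gamma> \<turnstile> \<phi> \<Longrightarrow> \<exists>F\<subseteq>\<Gamma>. finite F \<and> F \<turnstile> \<phi>"
proof (induction rule: proves.induct)
  case (Assm \<phi> \<Gamma>)
  then show ?case by (intro exI[of _ "{\<phi>}"]) (auto intro: proves.Assm)
next
  case (ImpI \<phi> \<Gamma> \<psi>)
  then obtain F where F: "F \<subseteq> insert \<phi> \<Gamma>" "finite F" "F \<turnstile> \<psi>" by blast
  then have "insert \<phi> (F - {\<phi>}) \<turnstile> \<psi>" by (blast intro: proves_mono)
  with F show ?case by (intro exI[of _ "F - {\<phi>}"]) (auto intro: proves.ImpI)
next
  case (ImpE \<Gamma> \<phi> \<psi>)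
  then obtain F G where "F \<subseteq> \<Gamma>" "finite F" "F \<turnstile> ImpF \<phi> \<psi>" "G \<subseteq> \<Gamma>" "finite G" "G \<turnstile> \<phi>" by blast
  then show ?case
    by (intro exI[of _ "F \<union> G"]) (auto intro: proves.ImpE proves_mono)
next
  case (Raa \<phi> \<Gamma>)
  then obtain F where F: "F \<subseteq> insert (NegF \<phi>) \<Gamma>" "finite F" "F \<turnstile> BotF" by blast
  then have "insert (NegF \<phi>) (F - {NegF \<phi>}) \<turnstile> BotF" by (blast intro: proves_mono)
  with F show ?case by (intro exI[of _ "F - {NegF \<phi>}"]) (auto intro: proves.Raa)
next
  case (AllI \<Gamma> \<phi>)
  then obtain F where "F \<subseteq> ren Suc ` \<Gamma>" "finite F" "F \<turnstile> \<phi>" by blast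
  then show ?case by (metis finite_subset_image proves.AllI)
next
  case (AllE \<Gamma> \<phi> t)
  then show ?case by (blast intro: proves.AllE)
next
  case (EqI \<Gamma> t)
  then show ?case by (blast intro: proves.EqI)
next
  case (EqE \<Gamma> s t \<phi>)
  then obtain F G where "F \<subseteq> \<Gamma>" "finite F" "F \<turnstile> EqF s t" "G \<subseteq> \<Gamma>" "finite G" "G \<turnstile> inst \<phi> s"
    by blast
  then show ?case
    by (intro exI[of _ "F \<union> G"]) (auto intro: proves.EqE proves_mono)
qed


section \<open>Semantics and soundness\<close>

text \<open>The domain \<open>U\<close> is a set inside a type because two kinds of domain occur:
  all of the type for the ambient model, and the elements of one transitive set for the
  relativization of a formula to that set.\<close>

primrec ev :: "'a set \<Rightarrow> ('a \<Rightarrow> 'a \<Rightarrow> bool) \<Rightarrow> (nat \<Rightarrow> 'a) \<Rightarrow> fm \<Rightarrow> bool" where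
  "ev U E e (MemF i j) = E (e i) (e j)"
| "ev U E e (EqF i j) = (e i = e j)"
| "ev U E e BotF = False"
| "ev U E e (ImpF \<phi> \<psi>) = (ev U E e \<phi> \<longrightarrow> ev U E e \<psi>)"
| "ev U E e (AllF \<phi>) = (\<forall>a\<in>U. ev U E (case_nat a e) \<phi>)"

lemma ev_cong: "(\<And>i. i \<in> fv \<phi> \<Longrightarrow> e i = f i) \<Longrightarrow> ev U E e \<phi> = ev U E f \<phi>"
proof (induction \<phi> arbitrary: e f)
  case (AllF \<phi>)
  have "ev U E (case_nat a e) \<phi> = ev U E (case_nat a f) \<phi>" for a
    using AllF.prems by (intro AllF.IH) (auto split: nat.split)
  then show ?case by simp
next
  case (ImpF \<phi> \<psi>)
  have "ev U E e \<phi> = ev U E f \<phi>" "ev U E e \<psi> = ev U E f \<psi>"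
    using ImpF.prems by (intro ImpF.IH; simp)+
  then show ?case by simp
qed simp_all

lemma ev_ren: "ev U E e (ren \<rho> \<phi>) = ev U E (e \<circ> \<rho>) \<phi>"
proof (induction \<phi> arbitrary: e \<rho>)
  case (AllF \<phi>)
  have "case_nat a e \<circ> case_nat 0 (Suc \<circ> \<rho>) = case_nat a (e \<circ> \<rho>)" for a
    by (auto split: nat.split)
  with AllF show ?case by (simp del: comp_apply)
qed simp_all

lemma ev_inst: "ev U E e (inst \<phi> t) = ev U E (case_nat (e t) e) \<phi>"
proof -
  have "e \<circ> case_nat t id = case_nat (e t) e" by (auto split: nat.split)
  then show ?thesis by (simp add: inst_def ev_ren)
qed

theorem soundness:
  "\<Gamma> \<turnstile> \<phi> \<Longrightarrow> range e \<subseteq> U \<Longrightarrow> \<forall>\<psi>\<in>\<Gamma>. ev U E e \<psi> \<Longrightarrow> ev U E e \<phi>"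
proof (induction arbitrary: e rule: proves.induct)
  case (AllI \<Gamma> \<phi>)
  have "ev U E (case_nat a e) \<phi>" if "a \<in> U" for a
  proof (rule AllI.IH)
    show "range (case_nat a e) \<subseteq> U"
      using that AllI.prems(1) by (auto simp: image_subset_iff split: nat.split)
    have "case_nat a e \<circ> Suc = e" by auto
    then show "\<forall>\<psi>\<in>ren Suc ` \<Gamma>. ev U E (case_nat a e) \<psi>"
      using AllI.prems(2) by (simp add: ev_ren)
  qed
  then show ?case by simp
next
  case (AllE \<Gamma> \<phi> t)
  then have "e t \<in> U" by auto
  with AllE show ?case by (simp add: ev_inst)
next
  case (EqE \<Gamma> s t \<phi>)
  then show ?case by (metis ev.simps(2) ev_inst)
qed auto

text \<open>Isomorphism invariance; it later moves a model on an infinite set of numbers to one on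
  all of \<open>nat\<close>.\<close>

lemma ev_bij:
  assumes "bij_betw h U U'"
    and "\<And>a b. a \<in> U \<Longrightarrow> b \<in> U \<Longrightarrow> E' (h a) (h b) = E a b"
    and "range e \<subseteq> U"
  shows "ev U' E' (h \<circ> e) \<phi> = ev U E e \<phi>"
  using assms(3)
proof (induction \<phi> arbitrary: e)
  case (EqF i j)
  then have "e i \<in> U" "e j \<in> U" by auto
  then show ?case using assms(1) by (auto simp: bij_betw_def inj_on_def)
next
  case (AllF \<phi>)
  have U': "U' = h ` U" using assms(1) by (simp add: bij_betw_def)
  have "ev U' E' (case_nat (h a) (h \<circ> e)) \<phi> = ev U E (case_nat a e) \<phi>" if "a \<in> U" for a
    unfolding case_nat_comp using AllF.prems that
    by (intro AllF.IH) (auto simp: image_subset_iff split: nat.split)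
  then show ?case by (simp add: U' del: comp_apply)
qed (use assms(2) in \<open>simp_all add: image_subset_iff\<close>)


section \<open>Completeness\<close>

lemma cut: "insert \<phi> \<Gamma> \<turnstile> \<psi> \<Longrightarrow> \<Gamma> \<turnstile> \<phi> \<Longrightarrow> \<Gamma> \<turnstile> \<psi>"
  by (blast intro: ImpI ImpE)

lemma explosion: "\<Gamma> \<turnstile> BotF \<Longrightarrow> \<Gamma> \<turnstile> \<phi>"
  by (meson Raa proves_mono subset_insertI)

lemma generalization:
  assumes "\<Gamma> \<turnstile> inst \<phi> c" and "c \<notin> \<Union> (fv ` \<Gamma>)" and "c \<notin> fv (AllF \<phi>)"
  shows "\<Gamma> \<turnstile> AllF \<phi>"
proof -
  \<comment> \<open>On formulas without \<open>c\<close> this renaming is the shift demanded by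
    \<open>AllI\<close>; on \<open>inst \<phi> c\<close> it turns \<open>c\<close> back into the
    bound variable 0 and restores \<open>\<phi>\<close>.\<close>
  define \<rho> where "\<rho> = Suc(c := 0)"
  have "ren \<rho> \<psi> = ren Suc \<psi>" if "\<psi> \<in> \<Gamma>" for \<psi>
    using that assms(2) by (intro ren_cong) (auto simp: \<rho>_def)
  then have "ren \<rho> ` \<Gamma> = ren Suc ` \<Gamma>" by (rule image_cong[OF refl])
  moreover have "ren \<rho> (inst \<phi> c) = ren (\<lambda>i. i) \<phi>"
    unfolding inst_def ren_ren using assms(3)
    by (intro ren_cong) (auto simp: \<rho>_def split: nat.split)
  ultimately show ?thesis
    using proves_ren[OF assms(1), of \<rho>] by (simp add: AllI ren_ident)
qed

section \<open>The Henkin construction\<close>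

definition consistent :: "fm set \<Rightarrow> bool" where
  "consistent \<Gamma> \<longleftrightarrow> \<not> \<Gamma> \<turnstile> BotF"

definition fresh :: "fm set \<Rightarrow> nat" where
  "fresh \<Gamma> = (SOME c. c \<notin> \<Union> (fv ` \<Gamma>))"

text \<open>Variables play the role of Henkin constants. The set is empty unless the formula is a
  negated universal, and then it has a single element that names a counterexample.\<close>

definition witness :: "fm set \<Rightarrow> fm \<Rightarrow> fm set" where
  "witness \<Gamma> \<phi> = {NegF (inst \<chi> (fresh (insert \<phi> \<Gamma>))) | \<chi>. \<phi> = NegF (AllF \<chi>)}"

primrec henkin :: "fm set \<Rightarrow> nat \<Rightarrow> fm set" where
  "henkin \<Gamma> 0 = \<Gamma>"
| "henkin \<Gamma> (Suc n) = (let \<phi> = from_nat n in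
     if consistent (insert \<phi> (henkin \<Gamma> n))
     then insert \<phi> (henkin \<Gamma> n) \<union> witness (henkin \<Gamma> n) \<phi> else henkin \<Gamma> n)"

lemma finite_witness: "finite (witness \<Gamma> \<phi>)"
proof -
  have "witness \<Gamma> \<phi> \<subseteq> (\<lambda>\<chi>. NegF (inst \<chi> (fresh (insert \<phi> \<Gamma>)))) ` {\<chi>. \<phi> = NegF (AllF \<chi>)}"
    by (auto simp: witness_def)
  moreover have "finite {\<chi>. \<phi> = NegF (AllF \<chi>)}"
    by (rule finite_subset[of _ "{THE \<chi>. \<phi> = NegF (AllF \<chi>)}"]) auto
  ultimately show ?thesis by (meson finite_imageI finite_subset)
qed

lemma henkin_mono: "m \<le> n \<Longrightarrow> henkin \<Gamma> m \<subseteq> henkin \<Gamma> n"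
  by (rule lift_Suc_mono_le[of "henkin \<Gamma>"]) (auto simp: Let_def)

lemma henkin_finite: "finite (henkin \<Gamma> n - \<Gamma>)"
proof (induction n)
  case (Suc n)
  have "henkin \<Gamma> (Suc n) - \<Gamma>
      \<subseteq> insert (from_nat n) (henkin \<Gamma> n - \<Gamma>) \<union> witness (henkin \<Gamma> n) (from_nat n)"
    by (auto simp: Let_def)
  with Suc show ?case by (meson finite_UnI finite_insert finite_subset finite_witness)
qed simp

lemma henkin_fresh:
  assumes "infinite (- \<Union> (fv ` \<Gamma>))"
  shows "fresh (insert \<phi> (henkin \<Gamma> n)) \<notin> \<Union> (fv ` insert \<phi> (henkin \<Gamma> n))"
proof -
  let ?F = "\<Union> (fv ` insert \<phi> (henkin \<Gamma> n - \<Gamma>))"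
  have "finite ?F" using henkin_finite finite_fv by auto
  then have "infinite (- \<Union> (fv ` \<Gamma>) - ?F)" using assms by simp
  then obtain c where "c \<in> - \<Union> (fv ` \<Gamma>) - ?F" using infinite_imp_nonempty by blast
  then have "c \<notin> \<Union> (fv ` insert \<phi> (henkin \<Gamma> n))" by auto
  then show ?thesis unfolding fresh_def by (rule someI)
qed

text \<open>If the counterexample at a fresh \<open>c\<close> were refutable, then
  \<open>inst \<chi> c\<close> would be derivable, and generalization over \<open>c\<close> would
  contradict the negated universal in \<Gamma>.\<close>

lemma consistent_witness:
  assumes "consistent \<Gamma>" and "NegF (AllF \<chi>) \<in> \<Gamma>" and "c \<notin> \<Union> (fv ` \<Gamma>)"
  shows "consistent (insert (NegF (inst \<chi> c)) \<Gamma>)"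
proof (rule ccontr)
  assume "\<not> ?thesis"
  then have "\<Gamma> \<turnstile> inst \<chi> c" by (auto simp: consistent_def intro: Raa)
  moreover have "c \<notin> fv (AllF \<chi>)" using assms(2,3) by fastforce
  ultimately have "\<Gamma> \<turnstile> AllF \<chi>" using assms(3) by (rule_tac generalization)
  then have "\<Gamma> \<turnstile> BotF" by (rule ImpE[OF Assm[OF assms(2)]])
  with assms(1) show False by (simp add: consistent_def)
qed

lemma henkin_consistent:
  assumes "infinite (- \<Union> (fv ` \<Gamma>))" and "consistent \<Gamma>"
  shows "consistent (henkin \<Gamma> n)"
proof (induction n)
  case (Suc n)
  let ?\<phi> = "from_nat n" and ?H = "henkin \<Gamma> n"
  show ?case
  proof (cases "consistent (insert ?\<phi> ?H)")
    case True
    show ?thesis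
    proof (cases "\<exists>\<chi>. ?\<phi> = NegF (AllF \<chi>)")
      case True
      then obtain \<chi> where \<chi>: "?\<phi> = NegF (AllF \<chi>)" by blast
      have "consistent (insert (NegF (inst \<chi> (fresh (insert ?\<phi> ?H)))) (insert ?\<phi> ?H))"
        by (rule consistent_witness[OF \<open>consistent (insert ?\<phi> ?H)\<close> _ henkin_fresh[OF assms(1)]])
          (simp add: \<chi>)
      then show ?thesis using \<open>consistent (insert ?\<phi> ?H)\<close> \<chi> by (simp add: witness_def Let_def)
    qed (use True in \<open>simp add: witness_def Let_def\<close>)
  qed (use Suc in simp)
qed (simp add: assms)

section \<open>Truth in the term model of a maximal consistent set with witnesses\<close>

locale henkin_set =
  fixes \<Delta> :: "fm set"
  assumes cons: "consistent \<Delta>"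
    and max: "consistent (insert \<phi> \<Delta>) \<Longrightarrow> \<phi> \<in> \<Delta>"
    and wit: "NegF (AllF \<chi>) \<in> \<Delta> \<Longrightarrow> \<exists>c. NegF (inst \<chi> c) \<in> \<Delta>"
begin

lemma closed: "\<Delta> \<turnstile> \<phi> \<longleftrightarrow> \<phi> \<in> \<Delta>"
  using cons max by (meson Assm consistent_def cut)

lemma neg_iff: "NegF \<phi> \<in> \<Delta> \<longleftrightarrow> \<phi> \<notin> \<Delta>"
  by (metis Assm ImpE ImpI closed cons consistent_def max)

lemma imp_iff: "ImpF \<phi> \<psi> \<in> \<Delta> \<longleftrightarrow> (\<phi> \<in> \<Delta> \<longrightarrow> \<psi> \<in> \<Delta>)"
proof
  assume "\<phi> \<in> \<Delta> \<longrightarrow> \<psi> \<in> \<Delta>"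
  then consider "\<phi> \<notin> \<Delta>" | "\<psi> \<in> \<Delta>" by blast
  then have "insert \<phi> \<Delta> \<turnstile> \<psi>"
  proof cases
    case 1
    then show ?thesis using max explosion consistent_def by blast
  qed (simp add: Assm)
  then show "ImpF \<phi> \<psi> \<in> \<Delta>" using ImpI closed by blast
qed (metis ImpE closed)

lemma all_iff: "AllF \<phi> \<in> \<Delta> \<longleftrightarrow> (\<forall>t. inst \<phi> t \<in> \<Delta>)"
  by (metis AllE closed neg_iff wit)

lemma eq_refl: "EqF t t \<in> \<Delta>"
  using EqI closed by blast

lemma eq_subst: "EqF s t \<in> \<Delta> \<Longrightarrow> inst \<phi> s \<in> \<Delta> \<Longrightarrow> inst \<phi> t \<in> \<Delta>"
  using EqE closed by blast

lemma eq_sym: "EqF s t \<in> \<Delta> \<Longrightarrow> EqF t s \<in> \<Delta>"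
  \<comment> \<open>Variable 0 is the place of substitution; \<open>inst\<close> lowers all others
    by one, whence \<open>Suc s\<close> for \<open>s\<close>.\<close>
  using eq_subst[of s t "EqF 0 (Suc s)"] eq_refl by (simp add: inst_def)

lemma eq_trans: "EqF s t \<in> \<Delta> \<Longrightarrow> EqF t u \<in> \<Delta> \<Longrightarrow> EqF s u \<in> \<Delta>"
  using eq_subst[of t u "EqF (Suc s) 0"] by (simp add: inst_def)

lemma mem_cong:
  assumes "EqF s s' \<in> \<Delta>" and "EqF t t' \<in> \<Delta>" and "MemF s t \<in> \<Delta>"
  shows "MemF s' t' \<in> \<Delta>"
  using eq_subst[of s s' "MemF 0 (Suc t)"] eq_subst[of t t' "MemF (Suc s') 0"] assms
  by (simp add: inst_def)

text \<open>The least provably equal variable represents its class. Choosing representatives instead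
  of forming a quotient keeps the domain a set of natural numbers.\<close>

definition rep :: "nat \<Rightarrow> nat" where
  "rep t = (LEAST s. EqF t s \<in> \<Delta>)"

lemma eq_rep: "EqF t (rep t) \<in> \<Delta>"
  unfolding rep_def by (rule LeastI) (rule eq_refl)

lemma rep_eq_iff: "rep s = rep t \<longleftrightarrow> EqF s t \<in> \<Delta>"
proof
  assume "EqF s t \<in> \<Delta>"
  then have "EqF s u \<in> \<Delta> \<longleftrightarrow> EqF t u \<in> \<Delta>" for u by (metis eq_sym eq_trans)
  then show "rep s = rep t" by (simp add: rep_def)
qed (metis eq_rep eq_sym eq_trans)

definition mem_rel :: "nat \<Rightarrow> nat \<Rightarrow> bool" where
  "mem_rel s t \<longleftrightarrow> MemF s t \<in> \<Delta>"

text \<open>The renaming is kept general because a quantifier extends it: the value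
  \<open>rep t\<close> for variable 0 corresponds to instantiating with \<open>t\<close>, and
  \<open>all_iff\<close> says that these instances decide the universal formula.\<close>

lemma truth: "ev (range rep) mem_rel (rep \<circ> \<rho>) \<phi> \<longleftrightarrow> ren \<rho> \<phi> \<in> \<Delta>"
proof (induction \<phi> arbitrary: \<rho>)
  case (MemF i j)
  show ?case by (simp add: mem_rel_def) (meson eq_rep eq_sym mem_cong)
next
  case BotF
  then show ?case using cons by (auto simp: consistent_def Assm)
next
  case (AllF \<phi>)
  then show ?case by (simp add: case_nat_comp all_iff inst_def ren_ren inst_lift del: comp_apply)
qed (simp_all add: rep_eq_iff imp_iff)

end

lemma henkin_set_exists:
  assumes "infinite (- \<Union> (fv ` \<Gamma>))" and "consistent \<Gamma>"
  shows "\<exists>\<Delta>. \<Gamma> \<subseteq> \<Delta> \<and> henkin_set \<Delta>"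
proof (intro exI conjI)
  let ?\<Delta> = "\<Union>n. henkin \<Gamma> n"
  have "\<Gamma> = henkin \<Gamma> 0" by simp
  then show "\<Gamma> \<subseteq> ?\<Delta>" by blast
  show "henkin_set ?\<Delta>"
  proof
    show cons: "consistent ?\<Delta>"
    proof (rule ccontr)
      assume "\<not> consistent ?\<Delta>"
      then obtain F where F: "finite F" "F \<subseteq> ?\<Delta>" "F \<turnstile> BotF"
        using proves_finite unfolding consistent_def by metis
      have "\<exists>n. F \<subseteq> henkin \<Gamma> n"
        using F(1,2)
      proof (induction F)
        case (insert \<phi> F)
        then obtain m n where "F \<subseteq> henkin \<Gamma> m" "\<phi> \<in> henkin \<Gamma> n" by blast
        then have "insert \<phi> F \<subseteq> henkin \<Gamma> (max m n)"
          using henkin_mono[of m "max m n" \<Gamma>] henkin_mono[of n "max m n" \<Gamma>] by auto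
        then show ?case ..
      qed simp
      with F(3) henkin_consistent[OF assms] show False
        by (meson consistent_def proves_mono)
    qed
    \<comment> \<open>A formula consistent with the whole union is consistent with the stage at
      which it is considered, so it was added there together with its witness.\<close>
    have step: "\<phi> \<in> henkin \<Gamma> (Suc (to_nat \<phi>))
        \<and> witness (henkin \<Gamma> (to_nat \<phi>)) \<phi> \<subseteq> henkin \<Gamma> (Suc (to_nat \<phi>))"
      if "consistent (insert \<phi> ?\<Delta>)" for \<phi>
    proof -
      have "consistent (insert \<phi> (henkin \<Gamma> (to_nat \<phi>)))"
        using that unfolding consistent_def by (meson UN_upper UNIV_I insert_mono proves_mono)
      then show ?thesis by (auto simp: Let_def)
    qed
    show "\<phi> \<in> ?\<Delta>" if "consistent (insert \<phi> ?\<Delta>)" for \<phi>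
      using step[OF that] by blast
    show "\<exists>c. NegF (inst \<chi> c) \<in> ?\<Delta>" if "NegF (AllF \<chi>) \<in> ?\<Delta>" for \<chi>
    proof -
      have "consistent (insert (NegF (AllF \<chi>)) ?\<Delta>)" using cons that by (simp add: insert_absorb)
      from step[OF this] show ?thesis unfolding witness_def by blast
    qed
  qed
qed

theorem completeness:
  assumes "\<And>(U :: nat set) E e. range e \<subseteq> U \<Longrightarrow> \<forall>\<phi>\<in>\<Gamma>. ev U E e \<phi> \<Longrightarrow> ev U E e \<psi>"
  shows "\<Gamma> \<turnstile> \<psi>"
proof (rule ccontr)
  assume not: "\<not> \<Gamma> \<turnstile> \<psi>"
  \<comment> \<open>The given formulas may use every variable. Doubling the indices frees the odd
    ones for witnesses, and halving undoes the doubling.\<close>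
  define \<rho> :: "nat \<Rightarrow> nat" where "\<rho> i = 2 * i" for i
  let ?\<Gamma> = "ren \<rho> ` insert (NegF \<psi>) \<Gamma>"
  have "consistent ?\<Gamma>"
  proof (rule ccontr)
    assume "\<not> consistent ?\<Gamma>"
    then have "ren (\<lambda>i. i div 2) ` ?\<Gamma> \<turnstile> ren (\<lambda>i. i div 2) BotF"
      unfolding consistent_def by (intro proves_ren) simp
    moreover have "ren (\<lambda>i. i div 2) (ren \<rho> \<phi>) = \<phi>" for \<phi>
      unfolding ren_ren by (rule ren_ident) (simp add: \<rho>_def)
    ultimately have "insert (NegF \<psi>) \<Gamma> \<turnstile> BotF" by (simp add: image_image)
    with not show False using Raa by blast
  qed
  moreover have "infinite (- \<Union> (fv ` ?\<Gamma>))"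
  proof (rule infinite_super)
    show "range (\<lambda>i. 2 * i + 1) \<subseteq> - \<Union> (fv ` ?\<Gamma>)"
      by (auto simp: fv_ren \<rho>_def; presburger)
    show "infinite (range (\<lambda>i :: nat. 2 * i + 1))"
      by (rule range_inj_infinite) (simp add: inj_on_def)
  qed
  ultimately obtain \<Delta> where \<Delta>: "?\<Gamma> \<subseteq> \<Delta>" "henkin_set \<Delta>" using henkin_set_exists by blast
  interpret henkin_set \<Delta> by fact
  let ?ev = "ev (range rep) mem_rel (rep \<circ> \<rho>)"
  have "\<forall>\<phi>\<in>\<Gamma>. ?ev \<phi>" and "\<not> ?ev \<psi>"
    using \<Delta>(1) by (auto simp: truth neg_iff)
  with assms[of "rep \<circ> \<rho>" "range rep" mem_rel] show False by auto
qed


section \<open>Semantics of the notation with levels\<close>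

definition level_env :: "(nat \<Rightarrow> 'a) \<Rightarrow> nat \<Rightarrow> (nat \<Rightarrow> 'a) \<Rightarrow> nat \<Rightarrow> 'a" where
  "level_env e d v i = (if i < d then v (d - Suc i) else e (i - d))"

text \<open>Level \<open>x < d\<close> has the value \<open>v x\<close>; the environment \<open>e\<close> serves the variables that are still free
  at depth 0.\<close>

definition hold ::
  "'a set \<Rightarrow> ('a \<Rightarrow> 'a \<Rightarrow> bool) \<Rightarrow> (nat \<Rightarrow> 'a) \<Rightarrow> nat \<Rightarrow> (nat \<Rightarrow> 'a) \<Rightarrow> fml \<Rightarrow> bool" where
  "hold U E e d v p = ev U E (level_env e d v) (p d)"

lemma level_env_0 [simp]: "level_env e 0 v = e"
  by (simp add: level_env_def fun_eq_iff)

lemma level_env_Suc: "case_nat a (level_env e d v) = level_env e (Suc d) (v(d := a))"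
  by (auto simp: level_env_def fun_eq_iff split: nat.split)

lemma level_env_level: "x < d \<Longrightarrow> level_env e d v (d - Suc x) = v x"
  by (simp add: level_env_def)

lemma hold_mem [simp]: "x < d \<Longrightarrow> y < d \<Longrightarrow> hold U E e d v (x \<^bold>\<in> y) = E (v x) (v y)"
  by (simp add: hold_def mem_def level_env_level)

lemma hold_eq [simp]: "x < d \<Longrightarrow> y < d \<Longrightarrow> hold U E e d v (x \<^bold>= y) = (v x = v y)"
  by (simp add: hold_def eq_def level_env_level)

lemma hold_connectives [simp]:
  "hold U E e d v \<^bold>\<bottom> = False"
  "hold U E e d v (\<^bold>\<not> p) = (\<not> hold U E e d v p)"
  "hold U E e d v (p \<^bold>\<and> q) = (hold U E e d v p \<and> hold U E e d v q)"
  "hold U E e d v (p \<^bold>\<or> q) = (hold U E e d v p \<or> hold U E e d v q)"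
  "hold U E e d v (p \<^bold>\<longrightarrow> q) = (hold U E e d v p \<longrightarrow> hold U E e d v q)"
  "hold U E e d v (p \<^bold>\<longleftrightarrow> q) = (hold U E e d v p = hold U E e d v q)"
  by (auto simp: hold_def bot_def neg_def conj_def disj_def imp_def iff_def)

lemma hold_all [simp]: "hold U E e d v (all p) = (\<forall>a\<in>U. hold U E e (Suc d) (v(d := a)) (p d))"
  by (simp add: hold_def all_def level_env_Suc)

lemma hold_ex [simp]: "hold U E e d v (ex p) = (\<exists>a\<in>U. hold U E e (Suc d) (v(d := a)) (p d))"
  by (simp add: hold_def ex_def level_env_Suc)

lemma ev_close: "ev UNIV E e (close k p) = (\<forall>v. hold UNIV E e k v p)"
proof -
  \<comment> \<open>Generalized for the induction: \<open>d\<close> levels are already fixed by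
    \<open>v\<close>, and the next \<open>n\<close> quantifiers range over the levels from
    \<open>d\<close> on.\<close>
  have "ev UNIV E (level_env e d v) ((AllF ^^ n) \<phi>)
      = (\<forall>w. (\<forall>i<d. w i = v i) \<longrightarrow> ev UNIV E (level_env e (d + n) w) \<phi>)" for d n v \<phi>
  proof (induction n arbitrary: d v)
    case 0
    have "level_env e d w = level_env e d v" if "\<forall>i<d. w i = v i" for w
      using that by (auto simp: level_env_def fun_eq_iff)
    then show ?case by (metis add_0_right funpow_0)
  next
    case (Suc n)
    have "ev UNIV E (level_env e d v) ((AllF ^^ Suc n) \<phi>) =
        (\<forall>a w. (\<forall>i<Suc d. w i = (v(d := a)) i) \<longrightarrow> ev UNIV E (level_env e (d + Suc n) w) \<phi>)"
      by (simp add: level_env_Suc Suc.IH del: fun_upd_apply)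
    also have "\<dots> = (\<forall>w. (\<forall>i<d. w i = v i) \<longrightarrow> ev UNIV E (level_env e (d + Suc n) w) \<phi>)"
      by (simp add: less_Suc_eq) blast
    finally show ?case .
  qed
  from this[of 0 undefined k "p k"] show ?thesis by (simp add: close_def hold_def)
qed

text \<open>The bound on the free variables and \<open>k \<le> d\<close> send every variable of
  \<open>\<phi>\<close> to a level below \<open>d\<close>, so the outer environment \<open>e\<close>
  is never consulted.\<close>

lemma hold_app1:
  assumes "fv \<phi> \<subseteq> {..<k + 1}" and "k \<le> d" and "x < d"
  shows "hold UNIV E e d v (app1 \<phi> x) = ev UNIV E (case_nat (v x) v) \<phi>"
  unfolding hold_def app1_def ev_ren
  using assms by (intro ev_cong) (force simp: level_env_level split: nat.split)

lemma hold_app2: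
  assumes "fv \<phi> \<subseteq> {..<k + 2}" and "k \<le> d" and "x < d" and "y < d"
  shows "hold UNIV E e d v (app2 \<phi> x y) = ev UNIV E (case_nat (v x) (case_nat (v y) v)) \<phi>"
  unfolding hold_def app2_def ev_ren
  using assms by (intro ev_cong) (force simp: level_env_level split: nat.split)

text \<open>The formula \<open>p\<close> at level \<open>k\<close>, in the form expected by \<open>app1\<close>: the levels \<open>0, \<dots>, k - 1\<close> become
  the parameters, whose indices run in the opposite direction.\<close>

definition scheme_formula :: "nat \<Rightarrow> fml \<Rightarrow> fm" where
  "scheme_formula k p = ren (\<lambda>i. if i = 0 \<or> k < i then 0 else Suc (k - i)) (p (Suc k))"

lemma fv_scheme_formula: "fv (scheme_formula k p) \<subseteq> {..<k + 1}"
  by (auto simp: scheme_formula_def fv_ren)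

text \<open>The constant environment on the right arises because \<open>scheme_formula\<close> sends
  all indices beyond the parameters to 0, the index of the argument.\<close>

lemma ev_scheme_formula:
  "ev UNIV E (case_nat a v) (scheme_formula k p) = hold UNIV E (\<lambda>_. a) (Suc k) (v(k := a)) p"
proof -
  have "case_nat a v \<circ> (\<lambda>i. if i = 0 \<or> k < i then 0 else Suc (k - i))
      = level_env (\<lambda>_. a) (Suc k) (v(k := a))"
    by (auto simp: level_env_def fun_eq_iff)
  then show ?thesis by (simp add: scheme_formula_def ev_ren hold_def)
qed

text \<open>A theory with the axioms Empty set and Pair only has infinite models, so that countable models
  can be taken to have all of \<open>nat\<close> as their domain.\<close>

lemma infinite_model:
  assumes "ev U E e (empty_set_ax 0)" and "ev U E e (pair_ax 0)"
  shows "infinite U"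
proof
  assume fin: "finite U"
  have "hold U E e 0 undefined empty_set_ax" and "hold U E e 0 undefined pair_ax"
    using assms by (simp_all add: hold_def)
  then have ex: "\<exists>z\<in>U. \<forall>w\<in>U. \<not> E w z"
      and "\<forall>x\<in>U. \<forall>y\<in>U. \<exists>s\<in>U. \<forall>w\<in>U. E w s \<longleftrightarrow> w = x \<or> w = y"
    by (simp_all add: empty_set_ax_def is_empty_def pair_ax_def is_upair_def)
  from this(2) have ex2: "\<forall>x\<in>U. \<exists>s\<in>U. \<forall>w\<in>U. E w s \<longleftrightarrow> w = x" by metis
  from ex obtain z where z: "z \<in> U" "\<forall>w\<in>U. \<not> E w z" ..
  from ex2 obtain f where f: "\<And>x. x \<in> U \<Longrightarrow> f x \<in> U" "\<And>x w. x \<in> U \<Longrightarrow> w \<in> U \<Longrightarrow> E w (f x) \<longleftrightarrow> w = x"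
    by metis
  \<comment> \<open>The map from x to {x} is injective. On a finite domain it would be onto and
    would have to produce the empty set.\<close>
  have "inj_on f U" by (rule inj_onI) (metis f(2))
  moreover have "f ` U \<subseteq> U" using f(1) by blast
  ultimately have "f ` U = U" using fin by (simp add: endo_inj_surj)
  with z obtain x where "x \<in> U" "z = f x" by blast
  with z f(2) show False by blast
qed

text \<open>With a whole type as domain the quantifiers of a model become plain HOL quantifiers, and
  the model can be treated as an interpretation of a locale.\<close>

theorem completeness_nat:
  assumes "\<Gamma> \<turnstile> empty_set_ax 0" and "\<Gamma> \<turnstile> pair_ax 0"
    and "\<And>(E :: nat \<Rightarrow> nat \<Rightarrow> bool) e. \<forall>\<phi>\<in>\<Gamma>. ev UNIV E e \<phi> \<Longrightarrow> ev UNIV E e \<psi>"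
  shows "\<Gamma> \<turnstile> \<psi>"
proof (rule completeness)
  fix U :: "nat set" and E e
  assume U: "range e \<subseteq> U" "\<forall>\<phi>\<in>\<Gamma>. ev U E e \<phi>"
  have "infinite U" using infinite_model soundness[OF assms(1) U] soundness[OF assms(2) U] by blast
  then obtain h :: "nat \<Rightarrow> nat" where h: "bij_betw h UNIV U"
    using bij_enumerate by blast
  let ?E = "\<lambda>a b. E (h a) (h b)" and ?e = "inv h \<circ> e"
  have "h \<circ> ?e = e"
    using h U(1) by (auto simp: fun_eq_iff bij_betw_def intro!: f_inv_into_f)
  then have "ev U E e \<phi> \<longleftrightarrow> ev UNIV ?E ?e \<phi>" for \<phi>
    using ev_bij[OF h, of E ?E ?e \<phi>] by simp
  with assms(3) U(2) show "ev U E e \<psi>" by blast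
qed


section \<open>Elementary set theory in a model of BST\<close>

text \<open>The semantic content of the elementary axioms; \<open>ex_diff\<close> is the only
  instance of Separation among them.\<close>

locale bst =
  fixes E :: "'a \<Rightarrow> 'a \<Rightarrow> bool" (infix \<open>\<epsilon>\<close> 50)
  assumes ext: "(\<And>z. z \<epsilon> x \<longleftrightarrow> z \<epsilon> y) \<Longrightarrow> x = y"
    and ex_empty: "\<exists>x. \<forall>y. \<not> y \<epsilon> x"
    and ex_upair: "\<exists>z. \<forall>w. w \<epsilon> z \<longleftrightarrow> w = x \<or> w = y"
    and ex_union: "\<exists>z. \<forall>w. w \<epsilon> z \<longleftrightarrow> (\<exists>y. y \<epsilon> x \<and> w \<epsilon> y)"
    and ex_diff: "\<exists>b. \<forall>z. z \<epsilon> b \<longleftrightarrow> z \<epsilon> x \<and> \<not> z \<epsilon> y"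
begin

definition set_of :: "('a \<Rightarrow> bool) \<Rightarrow> 'a" where
  "set_of P = (THE z. \<forall>w. w \<epsilon> z \<longleftrightarrow> P w)"

lemma in_set_of: "\<exists>z. \<forall>w. w \<epsilon> z \<longleftrightarrow> P w \<Longrightarrow> w \<epsilon> set_of P \<longleftrightarrow> P w"
proof -
  assume "\<exists>z. \<forall>w. w \<epsilon> z \<longleftrightarrow> P w"
  then obtain z where z: "\<forall>w. w \<epsilon> z \<longleftrightarrow> P w" ..
  then have "set_of P = z" unfolding set_of_def by (intro the_equality) (auto intro: ext)
  with z show ?thesis by simp
qed

definition em :: 'a where "em = set_of (\<lambda>_. False)"
definition up :: "'a \<Rightarrow> 'a \<Rightarrow> 'a" where "up x y = set_of (\<lambda>w. w = x \<or> w = y)"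
definition bigun :: "'a \<Rightarrow> 'a" where "bigun x = set_of (\<lambda>w. \<exists>y. y \<epsilon> x \<and> w \<epsilon> y)"
definition un :: "'a \<Rightarrow> 'a \<Rightarrow> 'a" where "un x y = bigun (up x y)"
definition diff :: "'a \<Rightarrow> 'a \<Rightarrow> 'a" where "diff x y = set_of (\<lambda>w. w \<epsilon> x \<and> \<not> w \<epsilon> y)"
definition sg :: "'a \<Rightarrow> 'a" where "sg x = up x x"
definition pr :: "'a \<Rightarrow> 'a \<Rightarrow> 'a" where "pr x y = up (sg x) (up x y)"
definition suc :: "'a \<Rightarrow> 'a" where "suc x = un x (sg x)"

lemma in_em [simp]: "\<not> w \<epsilon> em"
  unfolding em_def using in_set_of[of "\<lambda>_. False"] ex_empty by simp

lemma in_up [simp]: "w \<epsilon> up x y \<longleftrightarrow> w = x \<or> w = y"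
  unfolding up_def by (rule in_set_of) (rule ex_upair)

lemma in_bigun [simp]: "w \<epsilon> bigun x \<longleftrightarrow> (\<exists>y. y \<epsilon> x \<and> w \<epsilon> y)"
  unfolding bigun_def by (rule in_set_of[OF ex_union])

lemma in_un [simp]: "w \<epsilon> un x y \<longleftrightarrow> w \<epsilon> x \<or> w \<epsilon> y"
  by (auto simp: un_def)

lemma in_diff [simp]: "w \<epsilon> diff x y \<longleftrightarrow> w \<epsilon> x \<and> \<not> w \<epsilon> y"
  unfolding diff_def by (rule in_set_of) (rule ex_diff)

lemma in_sg [simp]: "w \<epsilon> sg x \<longleftrightarrow> w = x"
  by (simp add: sg_def)

lemma in_suc [simp]: "w \<epsilon> suc x \<longleftrightarrow> w \<epsilon> x \<or> w = x"
  by (simp add: suc_def)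

lemma set_eq_iff: "x = y \<longleftrightarrow> (\<forall>z. z \<epsilon> x \<longleftrightarrow> z \<epsilon> y)"
  using ext by blast

lemma up_eq: "(\<forall>w. w \<epsilon> z \<longleftrightarrow> w = x \<or> w = y) \<longleftrightarrow> z = up x y"
  by (simp add: set_eq_iff[of z])

lemma sg_eq_up [simp]: "sg z = up x y \<longleftrightarrow> x = z \<and> y = z"
  by (metis in_sg in_up sg_def)

lemma sg_inject [simp]: "sg x = sg y \<longleftrightarrow> x = y"
  by (metis in_sg)

lemma pr_inject [simp]: "pr x y = pr x' y' \<longleftrightarrow> x = x' \<and> y = y'"
proof
  assume *: "pr x y = pr x' y'"
  have eq: "sg x = sg x' \<or> sg x = up x' y'" "sg x' = sg x \<or> sg x' = up x y"
      "up x y = sg x' \<or> up x y = up x' y'" "up x' y' = sg x \<or> up x' y' = up x y"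
    using * by (metis in_up pr_def)+
  then have "x = x'" by (metis sg_eq_up sg_inject)
  with eq(3,4) show "x = x' \<and> y = y'" by (metis in_sg in_up)
qed simp

lemma em_eq: "(\<forall>y. \<not> y \<epsilon> x) \<longleftrightarrow> x = em"
  by (metis in_em ext)

text \<open>Numerals of numbers outside the model. They are all in the \<omega> of the model, which
  may have further elements.\<close>

primrec nm :: "nat \<Rightarrow> 'a" where
  "nm 0 = em"
| "nm (Suc k) = suc (nm k)"

lemma in_nm: "z \<epsilon> nm k \<longleftrightarrow> (\<exists>j<k. z = nm j)"
  by (induction k) (auto simp: less_Suc_eq)

lemma nm_less_neq: "j < k \<Longrightarrow> nm j \<noteq> nm k"
proof (induction k arbitrary: j)
  case (Suc k)
  show ?case
  proof
    assume "nm j = nm (Suc k)"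
    then have "nm k \<epsilon> nm j" by simp
    then obtain i where "i < j" "nm k = nm i" by (auto simp: in_nm)
    with Suc show False by (metis less_Suc_eq less_trans_Suc Suc_less_eq)
  qed
qed simp

lemma nm_inject [simp]: "nm j = nm k \<longleftrightarrow> j = k"
  by (metis linorder_less_linear nm_less_neq)

definition Fun :: "'a \<Rightarrow> 'a \<Rightarrow> bool" where
  "Fun f A \<longleftrightarrow> (\<forall>p. p \<epsilon> f \<longrightarrow> (\<exists>x y. x \<epsilon> A \<and> p = pr x y)) \<and>
     (\<forall>x. x \<epsilon> A \<longrightarrow> (\<exists>y. pr x y \<epsilon> f \<and> (\<forall>z. pr x z \<epsilon> f \<longrightarrow> z = y)))"

definition Maps :: "'a \<Rightarrow> 'a \<Rightarrow> 'a \<Rightarrow> bool" where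
  "Maps f A B \<longleftrightarrow> Fun f A \<and> (\<forall>x y. pr x y \<epsilon> f \<longrightarrow> y \<epsilon> B)"

definition Comp :: "'a \<Rightarrow> 'a \<Rightarrow> 'a \<Rightarrow> bool" where
  "Comp f g h \<longleftrightarrow> (\<exists>A. Fun f A \<and> Fun h A \<and> (\<forall>x y z. pr x y \<epsilon> f \<and> pr y z \<epsilon> g \<longrightarrow> pr x z \<epsilon> h))"

definition Inductive :: "'a \<Rightarrow> bool" where
  "Inductive w \<longleftrightarrow> em \<epsilon> w \<and> (\<forall>x. x \<epsilon> w \<longrightarrow> suc x \<epsilon> w)"

definition Omega :: "'a \<Rightarrow> bool" where
  "Omega w \<longleftrightarrow> Inductive w \<and> (\<forall>z. Inductive z \<longrightarrow> (\<forall>n. n \<epsilon> w \<longrightarrow> n \<epsilon> z))"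

definition Natural :: "'a \<Rightarrow> bool" where
  "Natural n \<longleftrightarrow> (\<exists>w. Omega w \<and> n \<epsilon> w)"

abbreviation holds :: "(nat \<Rightarrow> 'a) \<Rightarrow> nat \<Rightarrow> (nat \<Rightarrow> 'a) \<Rightarrow> fml \<Rightarrow> bool" where
  "holds \<equiv> hold UNIV E"

lemma holds_is_subset [simp]:
  "x < d \<Longrightarrow> y < d \<Longrightarrow> holds e d v (is_subset x y) = (\<forall>z. z \<epsilon> v x \<longrightarrow> z \<epsilon> v y)"
  by (simp add: is_subset_def)

lemma holds_is_empty [simp]: "x < d \<Longrightarrow> holds e d v (is_empty x) = (v x = em)"
  by (simp add: is_empty_def em_eq)

lemma holds_is_upair [simp]:
  "x < d \<Longrightarrow> y < d \<Longrightarrow> z < d \<Longrightarrow> holds e d v (is_upair x y z) = (v z = up (v x) (v y))"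
  by (simp add: is_upair_def up_eq)

lemma holds_is_pair [simp]:
  "x < d \<Longrightarrow> y < d \<Longrightarrow> z < d \<Longrightarrow> holds e d v (is_pair x y z) = (v z = pr (v x) (v y))"
  by (simp add: is_pair_def pr_def sg_def)

lemma holds_pair_in [simp]:
  "x < d \<Longrightarrow> y < d \<Longrightarrow> f < d \<Longrightarrow> holds e d v (pair_in x y f) = (pr (v x) (v y) \<epsilon> v f)"
  by (simp add: pair_in_def)

lemma holds_is_succ [simp]:
  "x < d \<Longrightarrow> z < d \<Longrightarrow> holds e d v (is_succ x z) = (v z = suc (v x))"
  by (simp add: is_succ_def set_eq_iff)

lemma holds_is_transitive [simp]:
  "y < d \<Longrightarrow> holds e d v (is_transitive y) = (\<forall>x. x \<epsilon> v y \<longrightarrow> (\<forall>z. z \<epsilon> x \<longrightarrow> z \<epsilon> v y))"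
  by (simp add: is_transitive_def)

lemma holds_is_function [simp]:
  "f < d \<Longrightarrow> A < d \<Longrightarrow> holds e d v (is_function f A) = Fun (v f) (v A)"
  by (simp add: is_function_def Fun_def)

lemma holds_maps [simp]:
  "f < d \<Longrightarrow> A < d \<Longrightarrow> B < d \<Longrightarrow> holds e d v (maps f A B) = Maps (v f) (v A) (v B)"
  by (simp add: maps_def Maps_def)

lemma holds_is_comp [simp]:
  "f < d \<Longrightarrow> g < d \<Longrightarrow> h < d \<Longrightarrow> holds e d v (is_comp f g h) = Comp (v f) (v g) (v h)"
  by (simp add: is_comp_def Comp_def)

lemma holds_is_inductive [simp]: "w < d \<Longrightarrow> holds e d v (is_inductive w) = Inductive (v w)"
  by (simp add: is_inductive_def Inductive_def)

lemma holds_is_omega [simp]: "w < d \<Longrightarrow> holds e d v (is_omega w) = Omega (v w)"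
  by (simp add: is_omega_def Omega_def)

lemma holds_is_natural [simp]: "n < d \<Longrightarrow> holds e d v (is_natural n) = Natural (v n)"
  by (simp add: is_natural_def Natural_def)

lemma holds_is_num [simp]: "z < d \<Longrightarrow> holds e d v (is_num k z) = (v z = nm k)"
  by (induction k arbitrary: z d v) simp_all

definition seq2 :: "'a \<Rightarrow> 'a \<Rightarrow> 'a" where
  "seq2 x y = up (pr (nm 0) x) (pr (nm 1) y)"

lemma holds_is_seq2 [simp]:
  "x < d \<Longrightarrow> y < d \<Longrightarrow> w < d \<Longrightarrow> holds e d v (is_seq2 x y w) = (v w = seq2 (v x) (v y))"
  by (simp add: is_seq2_def seq2_def del: nm.simps is_num.simps)


section \<open>Satisfaction in a model of BST\<close>

definition Language :: "'a \<Rightarrow> bool" where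
  "Language L \<longleftrightarrow> (\<exists>R F. L = pr R F \<and> (\<exists>D w. Omega w \<and> Maps R D w) \<and> (\<exists>D w. Omega w \<and> Maps F D w))"

lemma holds_is_language [simp]: "L < d \<Longrightarrow> holds e d v (is_language L) = Language (v L)"
  by (simp add: is_language_def is_arity_def Language_def)

definition Structure :: "'a \<Rightarrow> 'a \<Rightarrow> bool" where
  "Structure L A \<longleftrightarrow> (\<exists>R F M I P G. L = pr R F \<and> A = pr M I \<and> I = pr P G \<and> (\<exists>x. x \<epsilon> M) \<and>
     (\<exists>D. Fun R D \<and> Fun P D) \<and>
     (\<forall>r n p. pr r n \<epsilon> R \<and> pr r p \<epsilon> P \<longrightarrow> (\<forall>s. s \<epsilon> p \<longrightarrow> Maps s n M)) \<and>
     (\<exists>D. Fun F D \<and> Fun G D) \<and>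
     (\<forall>f n g. pr f n \<epsilon> F \<and> pr f g \<epsilon> G \<longrightarrow> (\<exists>D. (\<forall>s. s \<epsilon> D \<longleftrightarrow> Maps s n M) \<and> Maps g D M)))"

lemma holds_is_structure [simp]:
  "L < d \<Longrightarrow> A < d \<Longrightarrow> holds e d v (is_structure L A) = Structure (v L) (v A)"
  by (simp add: is_structure_def is_power_def Structure_def)

definition tag :: "nat \<Rightarrow> 'a \<Rightarrow> 'a" where
  "tag k x = pr (nm k) x"

lemma tag_inject [simp]: "tag j x = tag k y \<longleftrightarrow> j = k \<and> x = y"
  by (simp add: tag_def)

lemma holds_tagged [simp]: "x < d \<Longrightarrow> z < d \<Longrightarrow> holds e d v (tagged k x z) = (v z = tag k (v x))"
  by (simp add: tagged_def tag_def)

lemma holds_tagged2 [simp]: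
  "x < d \<Longrightarrow> y < d \<Longrightarrow> z < d \<Longrightarrow> holds e d v (tagged2 k x y z) = (v z = tag k (pr (v x) (v y)))"
  by (simp add: tagged2_def)

lemma holds_codes [simp]:
  "z < d \<Longrightarrow> holds e d v (bot_code z) = (v z = tag 4 em)"
  "x < d \<Longrightarrow> z < d \<Longrightarrow> holds e d v (var_code x z) = (v z = tag 0 (v x))"
  "x < d \<Longrightarrow> y < d \<Longrightarrow> z < d \<Longrightarrow> holds e d v (fun_code x y z) = (v z = tag 1 (pr (v x) (v y)))"
  "x < d \<Longrightarrow> y < d \<Longrightarrow> z < d \<Longrightarrow> holds e d v (eq_code x y z) = (v z = tag 2 (pr (v x) (v y)))"
  "x < d \<Longrightarrow> y < d \<Longrightarrow> z < d \<Longrightarrow> holds e d v (rel_code x y z) = (v z = tag 3 (pr (v x) (v y)))"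
  "x < d \<Longrightarrow> y < d \<Longrightarrow> z < d \<Longrightarrow> holds e d v (imp_code x y z) = (v z = tag 5 (pr (v x) (v y)))"
  "x < d \<Longrightarrow> y < d \<Longrightarrow> z < d \<Longrightarrow> holds e d v (all_code x y z) = (v z = tag 6 (pr (v x) (v y)))"
  by (simp_all add: bot_code_def var_code_def fun_code_def eq_code_def rel_code_def imp_code_def
      all_code_def)

definition Entry :: "'a \<Rightarrow> 'a \<Rightarrow> bool" where
  "Entry c t \<longleftrightarrow> (\<exists>j. pr j t \<epsilon> c)"

definition Earlier :: "'a \<Rightarrow> 'a \<Rightarrow> 'a \<Rightarrow> bool" where
  "Earlier c k t \<longleftrightarrow> (\<exists>j. j \<epsilon> k \<and> pr j t \<epsilon> c)"

lemma holds_entry [simp]: "c < d \<Longrightarrow> t < d \<Longrightarrow> holds e d v (entry c t) = Entry (v c) (v t)"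
  by (simp add: entry_def Entry_def)

lemma holds_earlier [simp]:
  "c < d \<Longrightarrow> k < d \<Longrightarrow> t < d \<Longrightarrow> holds e d v (earlier c k t) = Earlier (v c) (v k) (v t)"
  by (simp add: earlier_def Earlier_def)

definition Term_seq :: "'a \<Rightarrow> 'a \<Rightarrow> 'a \<Rightarrow> bool" where
  "Term_seq L V c \<longleftrightarrow> (\<exists>R F n. L = pr R F \<and> Natural n \<and> Fun c n \<and>
     (\<forall>k t. pr k t \<epsilon> c \<longrightarrow>
        (\<exists>i. i \<epsilon> V \<and> t = tag 0 i) \<or>
        (\<exists>f m w. pr f m \<epsilon> F \<and> Fun w m \<and> (\<forall>l u. pr l u \<epsilon> w \<longrightarrow> Earlier c k u) \<and> t = tag 1 (pr f w))))"

lemma holds_term_seq [simp]: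
  "L < d \<Longrightarrow> V < d \<Longrightarrow> c < d \<Longrightarrow> holds e d v (term_seq L V c) = Term_seq (v L) (v V) (v c)"
  by (simp add: term_seq_def Term_seq_def)

definition Term :: "'a \<Rightarrow> 'a \<Rightarrow> 'a \<Rightarrow> bool" where
  "Term L V t \<longleftrightarrow> (\<exists>c. Term_seq L V c \<and> Entry c t)"

lemma holds_is_term [simp]:
  "L < d \<Longrightarrow> V < d \<Longrightarrow> t < d \<Longrightarrow> holds e d v (is_term L V t) = Term (v L) (v V) (v t)"
  by (simp add: is_term_def Term_def)

definition Formula_seq :: "'a \<Rightarrow> 'a \<Rightarrow> 'a \<Rightarrow> bool" where
  "Formula_seq L V c \<longleftrightarrow> (\<exists>R F n. L = pr R F \<and> Natural n \<and> Fun c n \<and>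
     (\<forall>k \<phi>. pr k \<phi> \<epsilon> c \<longrightarrow>
        (\<exists>t u. Term L V t \<and> Term L V u \<and> \<phi> = tag 2 (pr t u)) \<or>
        (\<exists>r m w. pr r m \<epsilon> R \<and> Fun w m \<and> (\<forall>l t. pr l t \<epsilon> w \<longrightarrow> Term L V t) \<and> \<phi> = tag 3 (pr r w)) \<or>
        \<phi> = tag 4 em \<or>
        (\<exists>p q. Earlier c k p \<and> Earlier c k q \<and> \<phi> = tag 5 (pr p q)) \<or>
        (\<exists>i p. i \<epsilon> V \<and> Earlier c k p \<and> \<phi> = tag 6 (pr i p))))"

lemma holds_formula_seq [simp]:
  "L < d \<Longrightarrow> V < d \<Longrightarrow> c < d \<Longrightarrow> holds e d v (formula_seq L V c) = Formula_seq (v L) (v V) (v c)"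
  by (simp add: formula_seq_def Formula_seq_def)

definition Formula :: "'a \<Rightarrow> 'a \<Rightarrow> 'a \<Rightarrow> bool" where
  "Formula L V \<phi> \<longleftrightarrow> (\<exists>c. Formula_seq L V c \<and> Entry c \<phi>)"

lemma holds_is_formula [simp]:
  "L < d \<Longrightarrow> V < d \<Longrightarrow> \<phi> < d \<Longrightarrow> holds e d v (is_formula L V \<phi>) = Formula (v L) (v V) (v \<phi>)"
  by (simp add: is_formula_def Formula_def)

definition Value :: "'a \<Rightarrow> 'a \<Rightarrow> 'a \<Rightarrow> 'a \<Rightarrow> 'a \<Rightarrow> 'a \<Rightarrow> bool" where
  "Value L A V s t a \<longleftrightarrow> (\<exists>M I P G c D h. A = pr M I \<and> I = pr P G \<and> Term_seq L V c \<and> Entry c t \<and>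
     (\<forall>u. u \<epsilon> D \<longleftrightarrow> Entry c u) \<and> Maps h D M \<and>
     (\<forall>u b. pr u b \<epsilon> h \<longrightarrow>
        (\<exists>i. u = tag 0 i \<and> pr i b \<epsilon> s) \<or>
        (\<exists>f w g x. u = tag 1 (pr f w) \<and> pr f g \<epsilon> G \<and> Comp w h x \<and> pr x b \<epsilon> g)) \<and>
     pr t a \<epsilon> h)"

lemma holds_has_value [simp]:
  "L < d \<Longrightarrow> A < d \<Longrightarrow> V < d \<Longrightarrow> s < d \<Longrightarrow> t < d \<Longrightarrow> a < d \<Longrightarrow>
    holds e d v (has_value L A V s t a) = Value (v L) (v A) (v V) (v s) (v t) (v a)"
  by (simp add: has_value_def Value_def)

definition Values :: "'a \<Rightarrow> 'a \<Rightarrow> 'a \<Rightarrow> 'a \<Rightarrow> 'a \<Rightarrow> 'a \<Rightarrow> bool" where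
  "Values L A V s w x \<longleftrightarrow> (\<exists>m. Fun w m \<and> Fun x m \<and>
     (\<forall>l t a. pr l t \<epsilon> w \<and> pr l a \<epsilon> x \<longrightarrow> Value L A V s t a))"

lemma holds_have_values [simp]:
  "L < d \<Longrightarrow> A < d \<Longrightarrow> V < d \<Longrightarrow> s < d \<Longrightarrow> w < d \<Longrightarrow> x < d \<Longrightarrow>
    holds e d v (have_values L A V s w x) = Values (v L) (v A) (v V) (v s) (v w) (v x)"
  by (simp add: have_values_def Values_def)

definition Variant :: "'a \<Rightarrow> 'a \<Rightarrow> 'a \<Rightarrow> 'a \<Rightarrow> 'a \<Rightarrow> bool" where
  "Variant V M i s s' \<longleftrightarrow> Maps s V M \<and> Maps s' V M \<and>
     (\<forall>j a. j \<epsilon> V \<and> j \<noteq> i \<longrightarrow> (pr j a \<epsilon> s \<longleftrightarrow> pr j a \<epsilon> s'))"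

lemma holds_variant [simp]:
  "V < d \<Longrightarrow> M < d \<Longrightarrow> i < d \<Longrightarrow> s < d \<Longrightarrow> s' < d \<Longrightarrow>
    holds e d v (variant V M i s s') = Variant (v V) (v M) (v i) (v s) (v s')"
  by (simp add: variant_def Variant_def)

definition Sat_relation :: "'a \<Rightarrow> 'a \<Rightarrow> 'a \<Rightarrow> 'a \<Rightarrow> 'a \<Rightarrow> bool" where
  "Sat_relation L A V c S \<longleftrightarrow> (\<exists>M I P G. A = pr M I \<and> I = pr P G \<and>
     (\<forall>\<phi> s. Entry c \<phi> \<and> Maps s V M \<longrightarrow>
       (pr \<phi> s \<epsilon> S \<longleftrightarrow>
        (\<exists>t u a. \<phi> = tag 2 (pr t u) \<and> Value L A V s t a \<and> Value L A V s u a) \<or>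
        (\<exists>r w p x. \<phi> = tag 3 (pr r w) \<and> pr r p \<epsilon> P \<and> Values L A V s w x \<and> x \<epsilon> p) \<or>
        (\<exists>p q. \<phi> = tag 5 (pr p q) \<and> (pr p s \<epsilon> S \<longrightarrow> pr q s \<epsilon> S)) \<or>
        (\<exists>i p. \<phi> = tag 6 (pr i p) \<and> (\<forall>s'. Variant V M i s s' \<longrightarrow> pr p s' \<epsilon> S)))))"

lemma holds_sat_relation [simp]:
  "L < d \<Longrightarrow> A < d \<Longrightarrow> V < d \<Longrightarrow> c < d \<Longrightarrow> S < d \<Longrightarrow>
    holds e d v (sat_relation L A V c S) = Sat_relation (v L) (v A) (v V) (v c) (v S)"
  by (simp add: sat_relation_def Sat_relation_def)

definition Sat :: "'a \<Rightarrow> 'a \<Rightarrow> 'a \<Rightarrow> 'a \<Rightarrow> bool" where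
  "Sat L A s \<phi> \<longleftrightarrow> (\<exists>V M I c S. Natural V \<and> A = pr M I \<and> Maps s V M \<and>
     Formula_seq L V c \<and> Entry c \<phi> \<and> Sat_relation L A V c S \<and> pr \<phi> s \<epsilon> S)"

lemma holds_sat [simp]:
  "L < d \<Longrightarrow> A < d \<Longrightarrow> s < d \<Longrightarrow> \<phi> < d \<Longrightarrow> holds e d v (sat L A s \<phi>) = Sat (v L) (v A) (v s) (v \<phi>)"
  by (simp add: sat_def Sat_def)

definition Models :: "'a \<Rightarrow> 'a \<Rightarrow> 'a \<Rightarrow> bool" where
  "Models L A \<phi> \<longleftrightarrow> (\<exists>V M I. Natural V \<and> A = pr M I \<and> Formula L V \<phi> \<and>
     (\<forall>s. Maps s V M \<longrightarrow> Sat L A s \<phi>))"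

lemma holds_models [simp]:
  "L < d \<Longrightarrow> A < d \<Longrightarrow> \<phi> < d \<Longrightarrow> holds e d v (models L A \<phi>) = Models (v L) (v A) (v \<phi>)"
  by (simp add: models_def Models_def)

definition Embedding :: "'a \<Rightarrow> 'a \<Rightarrow> 'a \<Rightarrow> 'a \<Rightarrow> bool" where
  "Embedding L A B j \<longleftrightarrow> (\<exists>M I N J. A = pr M I \<and> B = pr N J \<and> Maps j M N \<and>
     (\<forall>V \<phi> s s'. Natural V \<and> Formula L V \<phi> \<and> Maps s V M \<and> Comp s j s' \<longrightarrow>
        (Sat L A s \<phi> \<longleftrightarrow> Sat L B s' \<phi>)))"

lemma holds_is_elementary_embedding [simp]:
  "L < d \<Longrightarrow> A < d \<Longrightarrow> B < d \<Longrightarrow> j < d \<Longrightarrow>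
    holds e d v (is_elementary_embedding L A B j) = Embedding (v L) (v A) (v B) (v j)"
  by (simp add: is_elementary_embedding_def Embedding_def)

end


section \<open>Vopenka's Principle yields Replacement and Power Set\<close>

text \<open>\<open>ex_extract\<close> is the instance of bounded Separation that recovers the values
  y from the elements {{y}} of the structures.\<close>

locale bst_inf = bst +
  assumes ex_prod: "\<exists>z. \<forall>p. p \<epsilon> z \<longleftrightarrow> (\<exists>a b. a \<epsilon> x \<and> b \<epsilon> y \<and> p = pr a b)"
    and ex_omega: "\<exists>w. Omega w"
    and ex_extract: "\<exists>b. \<forall>z. z \<epsilon> b \<longleftrightarrow> z \<epsilon> x \<and> sg (sg z) \<epsilon> y"
begin

definition prod :: "'a \<Rightarrow> 'a \<Rightarrow> 'a" where
  "prod x y = set_of (\<lambda>p. \<exists>a b. a \<epsilon> x \<and> b \<epsilon> y \<and> p = pr a b)"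

lemma in_prod: "p \<epsilon> prod x y \<longleftrightarrow> (\<exists>a b. a \<epsilon> x \<and> b \<epsilon> y \<and> p = pr a b)"
  unfolding prod_def by (rule in_set_of[OF ex_prod])

lemma pr_in_prod [simp]: "pr a b \<epsilon> prod x y \<longleftrightarrow> a \<epsilon> x \<and> b \<epsilon> y"
  by (auto simp: in_prod)

lemma Omega_nm:
  assumes "Omega w"
  shows "nm k \<epsilon> w"
proof -
  have "em \<epsilon> w" and "x \<epsilon> w \<Longrightarrow> suc x \<epsilon> w" for x
    using assms unfolding Omega_def Inductive_def by blast+
  then show ?thesis by (induction k) simp_all
qed

lemma Natural_nm: "Natural (nm k)"
  unfolding Natural_def using ex_omega Omega_nm by blast

text \<open>0 serves as the number of variables, with the empty assignment, and 1 = {0} as the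
  length of formation sequences with one entry.\<close>

lemma Natural_em: "Natural em" and Natural_sg_em: "Natural (sg em)"
proof -
  show "Natural em" using Natural_nm[of 0] by simp
  have "suc em = sg em" by (rule ext) simp
  then show "Natural (sg em)" using Natural_nm[of 1] by simp
qed

lemma Fun_em [simp]: "Fun f em \<longleftrightarrow> f = em"
  by (auto simp: Fun_def em_eq)

lemma Fun_em_dom: "Fun em A \<longleftrightarrow> A = em"
  by (auto simp: Fun_def em_eq)

lemma Maps_em [simp]: "Maps f em B \<longleftrightarrow> f = em"
  by (auto simp: Maps_def)

lemma Fun_sg [simp]: "Fun (sg (pr x y)) (sg x)"
  by (auto simp: Fun_def)

text \<open>The language with a relation symbol of arity 0, i.e. a propositional variable, for each element
  of \<open>A\<close>; a structure with universe \<open>{y}\<close> then codes the pair of a subset \<open>B\<close> of \<open>A\<close> and \<open>y\<close>,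
  and the elementary theory of the structure determines \<open>B\<close>.\<close>

definition prop_language :: "'a \<Rightarrow> 'a" where
  "prop_language A = pr (prod A (sg em)) em"

text \<open>A relation of arity 0 on M is a subset of the set of empty sequences {0}. Thus a true
  propositional variable is interpreted by {0} and a false one by 0.\<close>

definition valuation :: "'a \<Rightarrow> 'a \<Rightarrow> 'a" where
  "valuation A B = un (prod B (sg (sg em))) (prod (diff A B) (sg em))"

definition prop_structure :: "'a \<Rightarrow> 'a \<Rightarrow> 'a \<Rightarrow> 'a" where
  "prop_structure A B y = pr (sg y) (pr (valuation A B) em)"

text \<open>3 is the tag of relational atoms, and \<open>em\<close> is the empty sequence of
  arguments.\<close>

definition atom :: "'a \<Rightarrow> 'a" where
  "atom a = tag 3 (pr a em)"

lemma sg_em_neq [simp]: "sg em \<noteq> em"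
  by (metis in_em in_sg)

lemma in_valuation:
  "p \<epsilon> valuation A B \<longleftrightarrow>
    (\<exists>a. a \<epsilon> B \<and> p = pr a (sg em)) \<or> (\<exists>a. a \<epsilon> A \<and> \<not> a \<epsilon> B \<and> p = pr a em)"
  by (auto simp: valuation_def in_prod)

lemma pr_in_valuation:
  "pr a p \<epsilon> valuation A B \<longleftrightarrow> a \<epsilon> B \<and> p = sg em \<or> a \<epsilon> A \<and> \<not> a \<epsilon> B \<and> p = em"
  by (auto simp: in_valuation)

lemma Fun_const: "Fun (prod A (sg b)) A"
  by (auto simp: Fun_def in_prod)

lemma Fun_valuation: "\<forall>x. x \<epsilon> B \<longrightarrow> x \<epsilon> A \<Longrightarrow> Fun (valuation A B) A"
  unfolding Fun_def pr_in_valuation by (auto simp: in_valuation)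

lemma Language_prop_language: "Language (prop_language A)"
proof -
  obtain w where w: "Omega w" using ex_omega ..
  then have "em \<epsilon> w" using Omega_nm[of w 0] by simp
  then have "Maps (prod A (sg em)) A w" by (simp add: Maps_def Fun_const)
  moreover have "Maps em em w" by simp
  ultimately show ?thesis unfolding Language_def prop_language_def using w by blast
qed

lemma Structure_prop_structure:
  assumes "\<forall>x. x \<epsilon> B \<longrightarrow> x \<epsilon> A"
  shows "Structure (prop_language A) (prop_structure A B y)"
proof -
  have "\<exists>x. x \<epsilon> sg y" by simp
  moreover have "\<exists>D. Fun (prod A (sg em)) D \<and> Fun (valuation A B) D"
    using Fun_const Fun_valuation[OF assms] by blast
  moreover have "\<forall>r n p. pr r n \<epsilon> prod A (sg em) \<and> pr r p \<epsilon> valuation A B \<longrightarrow>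
      (\<forall>s. s \<epsilon> p \<longrightarrow> Maps s n (sg y))"
    by (auto simp: pr_in_valuation)
  moreover have "\<exists>D. Fun em D \<and> Fun em D" by (auto simp: Fun_em_dom)
  moreover have "\<forall>f n g. pr f n \<epsilon> em \<and> pr f g \<epsilon> em \<longrightarrow>
      (\<exists>D. (\<forall>s. s \<epsilon> D \<longleftrightarrow> Maps s n (sg y)) \<and> Maps g D (sg y))"
    by simp
  ultimately show ?thesis
    unfolding Structure_def prop_language_def prop_structure_def by blast
qed

lemma Formula_seq_atom:
  assumes "a \<epsilon> A"
  shows "Formula_seq (prop_language A) V (sg (pr em (atom a)))"
  unfolding Formula_seq_def
proof (intro exI conjI allI impI)
  show "prop_language A = pr (prod A (sg em)) em" by (simp add: prop_language_def)
  show "Natural (sg em)" by (rule Natural_sg_em)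
  show "Fun (sg (pr em (atom a))) (sg em)" by simp
  fix k \<phi>
  assume "pr k \<phi> \<epsilon> sg (pr em (atom a))"
  then have "pr a em \<epsilon> prod A (sg em)" "\<phi> = tag 3 (pr a em)" "Fun em em"
    using assms by (simp_all add: atom_def)
  then show "(\<exists>t u. Term (prop_language A) V t \<and> Term (prop_language A) V u \<and> \<phi> = tag 2 (pr t u)) \<or>
      (\<exists>r m w. pr r m \<epsilon> prod A (sg em) \<and> Fun w m \<and> (\<forall>l t. pr l t \<epsilon> w \<longrightarrow> Term (prop_language A) V t)
        \<and> \<phi> = tag 3 (pr r w)) \<or>
      \<phi> = tag 4 em \<or>
      (\<exists>p q. Earlier (sg (pr em (atom a))) k p \<and> Earlier (sg (pr em (atom a))) k q \<and> \<phi> = tag 5 (pr p q)) \<or>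
      (\<exists>i p. i \<epsilon> V \<and> Earlier (sg (pr em (atom a))) k p \<and> \<phi> = tag 6 (pr i p))"
    by (metis in_em)
qed

lemma Entry_sg [simp]: "Entry (sg (pr i x)) y \<longleftrightarrow> y = x"
  by (auto simp: Entry_def)

lemma Formula_atom: "a \<epsilon> A \<Longrightarrow> Formula (prop_language A) V (atom a)"
  unfolding Formula_def using Formula_seq_atom Entry_sg by blast

lemma Sat_atom:
  assumes "a \<epsilon> A"
  shows "Sat (prop_language A) (prop_structure A B y) em (atom a) \<longleftrightarrow> a \<epsilon> B"
proof
  let ?L = "prop_language A" and ?A = "prop_structure A B y"
  assume "a \<epsilon> B"
  \<comment> \<open>The formation sequence has \<open>atom a\<close> as its only entry and the only
    assignment is empty, so one pair is a full satisfaction relation when the atom is true.\<close>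
  have "Sat_relation ?L ?A em (sg (pr em (atom a))) (sg (pr (atom a) em))"
    unfolding Sat_relation_def
  proof (intro exI conjI allI impI)
    show "?A = pr (sg y) (pr (valuation A B) em)" by (simp add: prop_structure_def)
    show "pr (valuation A B) em = pr (valuation A B) em" ..
    fix \<phi> s
    assume "Entry (sg (pr em (atom a))) \<phi> \<and> Maps s em (sg y)"
    then have "\<phi> = atom a" "s = em" by simp_all
    moreover have "pr a (sg em) \<epsilon> valuation A B" using \<open>a \<epsilon> B\<close> by (simp add: pr_in_valuation)
    moreover have "Values ?L ?A em em em em" by (auto simp: Values_def intro!: exI[of _ em])
    moreover have "em \<epsilon> sg em" by simp
    ultimately have "\<exists>r w p x. \<phi> = tag 3 (pr r w) \<and> pr r p \<epsilon> valuation A B \<and> Values ?L ?A em s w x \<and> x \<epsilon> p"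
      unfolding atom_def by blast
    then show "pr \<phi> s \<epsilon> sg (pr (atom a) em) \<longleftrightarrow>
        (\<exists>t u a. \<phi> = tag 2 (pr t u) \<and> Value ?L ?A em s t a \<and> Value ?L ?A em s u a) \<or>
        (\<exists>r w p x. \<phi> = tag 3 (pr r w) \<and> pr r p \<epsilon> valuation A B \<and> Values ?L ?A em s w x \<and> x \<epsilon> p) \<or>
        (\<exists>p q. \<phi> = tag 5 (pr p q) \<and>
          (pr p s \<epsilon> sg (pr (atom a) em) \<longrightarrow> pr q s \<epsilon> sg (pr (atom a) em))) \<or>
        (\<exists>i p. \<phi> = tag 6 (pr i p) \<and>
          (\<forall>s'. Variant em (sg y) i s s' \<longrightarrow> pr p s' \<epsilon> sg (pr (atom a) em)))"
      using \<open>\<phi> = atom a\<close> \<open>s = em\<close> by simp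
  qed
  moreover have "?A = pr (sg y) (pr (valuation A B) em)" by (simp add: prop_structure_def)
  moreover have "pr (atom a) em \<epsilon> sg (pr (atom a) em)" "Maps em em (sg y)"
    "Entry (sg (pr em (atom a))) (atom a)" by simp_all
  ultimately show "Sat ?L ?A em (atom a)"
    unfolding Sat_def using Natural_em Formula_seq_atom[OF assms] by blast
next
  assume "Sat (prop_language A) (prop_structure A B y) em (atom a)"
  then obtain V M I c S where *: "prop_structure A B y = pr M I" "Maps em V M" "Entry c (atom a)"
      "Sat_relation (prop_language A) (prop_structure A B y) V c S" "pr (atom a) em \<epsilon> S"
    unfolding Sat_def by blast
  \<comment> \<open>The tag 3 leaves only Tarski's clause for relations, and an interpretation with
    an element must be {0}, the value given exactly to the elements of \<open>B\<close>.\<close>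
  then show "a \<epsilon> B"
    unfolding Sat_relation_def by (fastforce simp: prop_structure_def atom_def pr_in_valuation)
qed

text \<open>Composition with \<open>j\<close> fixes the empty assignment, so elementarity says that
  both structures satisfy the same propositional variables; these decide membership for all elements
  of \<open>A\<close>.\<close>

lemma Embedding_prop_structure:
  assumes "Embedding (prop_language A) (prop_structure A B y) (prop_structure A B' y') j"
    and "\<forall>x. x \<epsilon> B \<longrightarrow> x \<epsilon> A" and "\<forall>x. x \<epsilon> B' \<longrightarrow> x \<epsilon> A"
  shows "B = B'"
proof -
  have Comp: "Comp em j em" by (auto simp: Comp_def intro: exI[of _ em])
  have "a \<epsilon> B \<longleftrightarrow> a \<epsilon> B'" if "a \<epsilon> A" for a
  proof -
    have "Sat (prop_language A) (prop_structure A B y) em (atom a)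
        \<longleftrightarrow> Sat (prop_language A) (prop_structure A B' y') em (atom a)"
      using assms(1) unfolding Embedding_def
      using Natural_em Formula_atom[OF that] Maps_em Comp by blast
    then show ?thesis by (simp add: Sat_atom that)
  qed
  with assms(2,3) show ?thesis by (metis ext)
qed

text \<open>Definability with finitely many parameters \<open>v\<close>, in the variable convention
  of the axiom schemes, so that a definable class is an instance of \<open>vp_ax\<close>.\<close>

definition definable :: "('a \<Rightarrow> bool) \<Rightarrow> bool" where
  "definable P \<longleftrightarrow>
    (\<exists>\<phi> k v. fv \<phi> \<subseteq> {..<k + 1} \<and> (\<forall>x. P x \<longleftrightarrow> ev UNIV E (case_nat x v) \<phi>))"

lemma definable_scheme: "(\<And>e x. holds e (Suc k) (v(k := x)) p \<longleftrightarrow> P x) \<Longrightarrow> definable P"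
  unfolding definable_def using ev_scheme_formula fv_scheme_formula by metis

definition is_valuation :: "nat \<Rightarrow> nat \<Rightarrow> nat \<Rightarrow> fml" where
  "is_valuation A B P = (\<^bold>\<forall>p. p \<^bold>\<in> P \<^bold>\<longleftrightarrow> (\<^bold>\<exists>a zero one. is_empty zero \<^bold>\<and> is_upair zero zero one \<^bold>\<and>
     (a \<^bold>\<in> B \<^bold>\<and> is_pair a one p \<^bold>\<or> a \<^bold>\<in> A \<^bold>\<and> \<^bold>\<not> a \<^bold>\<in> B \<^bold>\<and> is_pair a zero p)))"

definition is_prop_structure :: "nat \<Rightarrow> nat \<Rightarrow> nat \<Rightarrow> nat \<Rightarrow> fml" where
  "is_prop_structure A B y S = (\<^bold>\<exists>M P G I. is_upair y y M \<^bold>\<and> is_valuation A B P \<^bold>\<and> is_empty G \<^bold>\<and>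
     is_pair P G I \<^bold>\<and> is_pair M I S)"

lemma holds_is_valuation [simp]:
  "A < d \<Longrightarrow> B < d \<Longrightarrow> P < d \<Longrightarrow>
    holds e d v (is_valuation A B P) = (v P = valuation (v A) (v B))"
  unfolding is_valuation_def set_eq_iff[of "v P"] in_valuation
  by (simp add: sg_def[symmetric] ex_disj_distrib)

lemma holds_is_prop_structure [simp]:
  "A < d \<Longrightarrow> B < d \<Longrightarrow> y < d \<Longrightarrow> S < d \<Longrightarrow>
    holds e d v (is_prop_structure A B y S) = (v S = prop_structure (v A) (v B) (v y))"
  by (simp add: is_prop_structure_def prop_structure_def sg_def)

text \<open>The levels are laid out as follows: parameters of \<open>q\<close> below
  \<open>k\<close>, then \<open>A\<close> at \<open>k\<close>, the structure at
  \<open>k + 1\<close>, B at \<open>k + 2\<close> and y at \<open>k + 3\<close>. This is why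
  \<open>q\<close> is read at depth \<open>k + 4\<close>.\<close>

lemma definable_prop_structures:
  assumes "\<And>e v. (\<And>i. i < k \<Longrightarrow> v i = w i) \<Longrightarrow> holds e (k + 4) v q \<longleftrightarrow> Q (v (k + 2)) (v (k + 3))"
  shows "definable (\<lambda>S. \<exists>B y. (\<forall>x. x \<epsilon> B \<longrightarrow> x \<epsilon> A) \<and> Q B y \<and> S = prop_structure A B y)"
proof (rule definable_scheme)
  \<comment> \<open>The set \<open>A\<close> becomes one more parameter of the class.\<close>
  let ?w = "w(k := A)"
  let ?p = "\<^bold>\<exists>B y. is_subset B k \<^bold>\<and> q \<^bold>\<and> is_prop_structure k B y (Suc k)"
  have q: "holds e (Suc (Suc (Suc (Suc k))))
      (?w(Suc k := S, Suc (Suc k) := B, Suc (Suc (Suc k)) := y)) q \<longleftrightarrow> Q B y" for e S B y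
    using assms[of "?w(Suc k := S, Suc (Suc k) := B, Suc (Suc (Suc k)) := y)"]
    by (simp add: numeral_eq_Suc)
  show "holds e (Suc (Suc k)) (?w(Suc k := S)) ?p \<longleftrightarrow>
      (\<exists>B y. (\<forall>x. x \<epsilon> B \<longrightarrow> x \<epsilon> A) \<and> Q B y \<and> S = prop_structure A B y)" for e S
    by (simp add: q)
qed

end

locale vp_model = bst_inf +
  assumes vp: "definable P \<Longrightarrow> Language L \<Longrightarrow> (\<And>x. P x \<Longrightarrow> Structure L x) \<Longrightarrow>
      \<nexists>z. \<forall>x. x \<epsilon> z \<longleftrightarrow> P x \<Longrightarrow> \<exists>x y j. P x \<and> P y \<and> x \<noteq> y \<and> Embedding L x y j"
begin

text \<open>The common core of Replacement and Power set. Uniqueness of values is what turns B = B'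
  into equality of the structures, contradicting the two distinct structures that VP would provide
  for a proper class.\<close>

lemma collect_subset_images:
  assumes def: "\<And>e v. (\<And>i. i < k \<Longrightarrow> v i = w i) \<Longrightarrow>
        holds e (k + 4) v q \<longleftrightarrow> Q (v (k + 2)) (v (k + 3))"
    and unique: "\<And>B y z. Q B y \<Longrightarrow> Q B z \<Longrightarrow> y = z"
  shows "\<exists>b. \<forall>y. y \<epsilon> b \<longleftrightarrow> (\<exists>B. (\<forall>x. x \<epsilon> B \<longrightarrow> x \<epsilon> A) \<and> Q B y)"
proof -
  let ?P = "\<lambda>S. \<exists>B y. (\<forall>x. x \<epsilon> B \<longrightarrow> x \<epsilon> A) \<and> Q B y \<and> S = prop_structure A B y"
  have "\<exists>X. \<forall>S. S \<epsilon> X \<longleftrightarrow> ?P S"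
  proof (rule ccontr)
    assume none: "\<nexists>X. \<forall>S. S \<epsilon> X \<longleftrightarrow> ?P S"
    have "definable ?P" using def by (rule definable_prop_structures)
    moreover have "Structure (prop_language A) S" if "?P S" for S
      using that Structure_prop_structure by blast
    ultimately have "\<exists>S S' j. ?P S \<and> ?P S' \<and> S \<noteq> S' \<and> Embedding (prop_language A) S S' j"
      using none by (rule vp[OF _ Language_prop_language])
    then obtain B y B' y' j where *: "\<forall>x. x \<epsilon> B \<longrightarrow> x \<epsilon> A" "Q B y" "\<forall>x. x \<epsilon> B' \<longrightarrow> x \<epsilon> A" "Q B' y'"
        "prop_structure A B y \<noteq> prop_structure A B' y'"
        "Embedding (prop_language A) (prop_structure A B y) (prop_structure A B' y') j"
      by blast
    then have "B = B'" using Embedding_prop_structure by blast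
    with * unique show False by blast
  qed
  then obtain X where X: "\<And>S. S \<epsilon> X \<longleftrightarrow> ?P S" by blast
  have code: "sg (sg y) \<epsilon> bigun X \<longleftrightarrow> (\<exists>B. (\<forall>x. x \<epsilon> B \<longrightarrow> x \<epsilon> A) \<and> Q B y)" for y
  proof
    assume "sg (sg y) \<epsilon> bigun X"
    then obtain B z where "\<forall>x. x \<epsilon> B \<longrightarrow> x \<epsilon> A" "Q B z" "sg (sg y) \<epsilon> prop_structure A B z"
      using X by auto
    \<comment> \<open>Both components of the Kuratowski pair contain the universe {z}; so if {{y}}
      is one of them, then {z} = {y}.\<close>
    then have "sg z = sg y" unfolding prop_structure_def pr_def by auto
    with \<open>Q B z\<close> \<open>\<forall>x. x \<epsilon> B \<longrightarrow> x \<epsilon> A\<close> show "\<exists>B. (\<forall>x. x \<epsilon> B \<longrightarrow> x \<epsilon> A) \<and> Q B y" by auto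
  next
    assume "\<exists>B. (\<forall>x. x \<epsilon> B \<longrightarrow> x \<epsilon> A) \<and> Q B y"
    then obtain B where "prop_structure A B y \<epsilon> X" using X by blast
    moreover have "sg (sg y) \<epsilon> prop_structure A B y" by (simp add: prop_structure_def pr_def)
    ultimately show "sg (sg y) \<epsilon> bigun X" by auto
  qed
  obtain b where b: "\<And>y. y \<epsilon> b \<longleftrightarrow> y \<epsilon> bigun (bigun (bigun X)) \<and> sg (sg y) \<epsilon> bigun X"
    using ex_extract by blast
  \<comment> \<open>Unpacking {{y}} twice bounds the values by a set, after which Separation
    applies.\<close>
  have "y \<epsilon> bigun (bigun (bigun X))" if "sg (sg y) \<epsilon> bigun X" for y
    using that by (metis in_bigun in_sg)
  with b code show ?thesis by blast
qed

lemma power_set: "\<exists>b. \<forall>y. y \<epsilon> b \<longleftrightarrow> (\<forall>x. x \<epsilon> y \<longrightarrow> x \<epsilon> A)"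
proof -
  have "\<exists>b. \<forall>y. y \<epsilon> b \<longleftrightarrow> (\<exists>B. (\<forall>x. x \<epsilon> B \<longrightarrow> x \<epsilon> A) \<and> y = B)"
  proof (rule collect_subset_images)
    \<comment> \<open>Without parameters, level 2 holds B and level 3 holds y; the class function is
      the identity.\<close>
    show "holds e (0 + 4) v (3 \<^bold>= 2) \<longleftrightarrow> v (0 + 3) = v (0 + 2)" for e v
      by (simp add: numeral_eq_Suc)
  qed simp
  then show ?thesis by simp
qed

lemma replacement:
  assumes "fv \<phi> \<subseteq> {..<k + 2}"
    and "\<And>x y z. R x y \<Longrightarrow> R x z \<Longrightarrow> y = z"
    and "\<And>x y. R x y \<longleftrightarrow> ev UNIV E (case_nat x (case_nat y w)) \<phi>"
  shows "\<exists>b. \<forall>y. y \<epsilon> b \<longleftrightarrow> (\<exists>x. x \<epsilon> A \<and> R x y)"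
proof -
  have "\<exists>b. \<forall>y. y \<epsilon> b \<longleftrightarrow> (\<exists>B. (\<forall>x. x \<epsilon> B \<longrightarrow> x \<epsilon> A) \<and> (\<exists>x. B = sg x \<and> R x y))"
  proof (rule collect_subset_images)
    fix e v
    assume v: "\<And>i. i < k \<Longrightarrow> v i = w i"
    \<comment> \<open>The quantified x of "B = {x}" has level \<open>k + 4\<close>, above all
      parameters of \<open>\<phi>\<close>.\<close>
    have "ev UNIV E (case_nat x (case_nat y (v(k + 4 := x)))) \<phi> \<longleftrightarrow> R x y" for x y
      unfolding assms(3) using assms(1) v by (intro ev_cong) (force split: nat.split)
    then show "holds e (k + 4) v (\<^bold>\<exists>x. is_upair x x (k + 2) \<^bold>\<and> app2 \<phi> x (k + 3))
        \<longleftrightarrow> (\<exists>x. v (k + 2) = sg x \<and> R x (v (k + 3)))"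
      using assms(1) by (simp add: hold_app2 sg_def)
  qed (use assms(2) in auto)
  moreover have "(\<exists>B. (\<forall>x. x \<epsilon> B \<longrightarrow> x \<epsilon> A) \<and> (\<exists>x. B = sg x \<and> R x y)) \<longleftrightarrow> (\<exists>x. x \<epsilon> A \<and> R x y)" for y
    by (auto, metis in_sg)
  ultimately show ?thesis by simp
qed

text \<open>Replacement for the identity restricted to P. The renaming makes room for the second
  variable: the argument stays at 0 and the parameters skip index 1.\<close>

lemma separation:
  assumes "fv \<phi> \<subseteq> {..<k + 1}"
    and "\<And>x. P x \<longleftrightarrow> ev UNIV E (case_nat x w) \<phi>"
  shows "\<exists>b. \<forall>x. x \<epsilon> b \<longleftrightarrow> x \<epsilon> A \<and> P x"
proof -
  let ?\<psi> = "AndF (EqF 0 1) (ren (case_nat 0 (\<lambda>i. i + 2)) \<phi>)"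
  have "\<exists>b. \<forall>y. y \<epsilon> b \<longleftrightarrow> (\<exists>x. x \<epsilon> A \<and> (x = y \<and> P x))"
  proof (rule replacement)
    show "fv ?\<psi> \<subseteq> {..<k + 2}"
      using assms(1) by (auto simp: fv_ren split: nat.split)
    have "case_nat x (case_nat y w) \<circ> case_nat 0 (\<lambda>i. i + 2) = case_nat x w" for x y
      by (auto split: nat.split)
    then show "(x = y \<and> P x) \<longleftrightarrow> ev UNIV E (case_nat x (case_nat y w)) ?\<psi>" for x y
      by (auto simp: ev_ren assms(2))
  qed auto
  then show ?thesis by metis
qed

end


section \<open>Transitive models of ZFC inside a model of BST\<close>

lemma sentence_foundation: "sentence (foundation_ax 0)"
  by (auto simp: sentence_def foundation_ax_def all_def ex_def imp_def conj_def neg_def mem_def)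

lemma sentence_choice: "sentence (choice_ax 0)"
  by (auto simp: sentence_def choice_ax_def is_function_def pair_in_def is_pair_def is_upair_def
      all_def ex_def imp_def iff_def conj_def disj_def neg_def mem_def eq_def)

context bst_inf
begin

lemma pr_in_seq2: "pr l t \<epsilon> seq2 x y \<longleftrightarrow> l = nm 0 \<and> t = x \<or> l = nm 1 \<and> t = y"
  by (auto simp: seq2_def simp del: nm.simps)

lemma Fun_seq2: "Fun (seq2 x y) (up (nm 0) (nm 1))"
  by (auto simp: Fun_def pr_in_seq2 simp del: nm.simps) (auto simp: seq2_def simp del: nm.simps)

text \<open>The set described by \<open>quote\<close>, computed by recursion outside the model.
  Index \<open>i\<close> under \<open>k\<close> quantifiers becomes the variable numbered by its
  level \<open>k - Suc i\<close>.\<close>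

primrec code :: "nat \<Rightarrow> fm \<Rightarrow> 'a" where
  "code k (MemF i j) =
    tag 3 (pr em (seq2 (tag 0 (nm (k - Suc i))) (tag 0 (nm (k - Suc j)))))"
| "code k (EqF i j) = tag 2 (pr (tag 0 (nm (k - Suc i))) (tag 0 (nm (k - Suc j))))"
| "code k BotF = tag 4 em"
| "code k (ImpF \<phi> \<psi>) = tag 5 (pr (code k \<phi>) (code k \<psi>))"
| "code k (AllF \<phi>) = tag 6 (pr (nm k) (code (Suc k) \<phi>))"

lemma holds_quote [simp]: "x < d \<Longrightarrow> holds e d v (quote k \<phi> x) = (v x = code k \<phi>)"
  by (induction \<phi> arbitrary: k x d v)
    (simp_all add: cMem_def cEq_def cImp_def cAll_def del: is_num.simps)

definition mem_language :: 'a where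
  "mem_language = pr (sg (pr (nm 0) (nm 2))) em"

lemma holds_is_mem_language [simp]:
  "x < d \<Longrightarrow> holds e d v (is_mem_language x) = (v x = mem_language)"
  by (simp add: is_mem_language_def mem_language_def sg_def del: is_num.simps nm.simps)

definition mem_structure :: "'a \<Rightarrow> 'a \<Rightarrow> 'a" where
  "mem_structure y Q = pr y (pr (sg (pr em Q)) em)"

text \<open>A predicate and not a set operation, since the set of coded membership pairs is supplied
  by \<open>Loc_ZFC\<close> as part of the structure.\<close>

definition mem_pairs :: "'a \<Rightarrow> 'a \<Rightarrow> bool" where
  "mem_pairs y Q \<longleftrightarrow> (\<forall>s. s \<epsilon> Q \<longleftrightarrow> (\<exists>a b. a \<epsilon> y \<and> b \<epsilon> y \<and> a \<epsilon> b \<and> s = seq2 a b))"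

lemma mem_pairs_ex:
  assumes "mem_pairs y Q"
  shows "(\<exists>x. x \<epsilon> Q \<and> W x) \<longleftrightarrow> (\<exists>a b. a \<epsilon> y \<and> b \<epsilon> y \<and> a \<epsilon> b \<and> W (seq2 a b))"
proof -
  have "x \<epsilon> Q \<longleftrightarrow> (\<exists>a b. a \<epsilon> y \<and> b \<epsilon> y \<and> a \<epsilon> b \<and> x = seq2 a b)" for x
    using assms unfolding mem_pairs_def by (rule spec)
  then show ?thesis by (simp only:) blast
qed

lemma holds_is_mem_structure [simp]:
  "y < d \<Longrightarrow> A < d \<Longrightarrow> holds e d v (is_mem_structure y A) =
    (\<exists>Q. mem_pairs (v y) Q \<and> v A = mem_structure (v y) Q)"
  by (simp add: is_mem_structure_def mem_structure_def mem_pairs_def sg_def)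

lemma holds_is_zfc_axiom:
  assumes "x < d" and "p \<in> set zfc_single_axioms" and "v x = code 0 (p 0)"
  shows "holds e d v (is_zfc_axiom x)"
proof -
  have "holds e d v (foldr (\<lambda>p q. quote 0 (p 0) x \<^bold>\<or> q) ps r)" if "p \<in> set ps" for ps r
    using that assms(1,3) by (induction ps) auto
  with assms(2) show ?thesis unfolding is_zfc_axiom_def by blast
qed

text \<open>The formula \<open>is_zfc_axiom\<close> stays uninterpreted: it is enough that the codes
  of the single axioms satisfy it.\<close>

lemma Loc_ZFC_code:
  assumes "ev UNIV E e (Loc_ZFC 0)"
  shows "\<exists>y Q. x \<epsilon> y \<and> (\<forall>a. a \<epsilon> y \<longrightarrow> (\<forall>b. b \<epsilon> a \<longrightarrow> b \<epsilon> y)) \<and> mem_pairs y Q \<and>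
    (\<forall>p\<in>set zfc_single_axioms. Models mem_language (mem_structure y Q) (code 0 (p 0)))"
proof -
  have "holds e 0 undefined Loc_ZFC" using assms by (simp add: hold_def)
  then have "\<forall>x. \<exists>y. x \<epsilon> y \<and> (\<forall>a. a \<epsilon> y \<longrightarrow> (\<forall>b. b \<epsilon> a \<longrightarrow> b \<epsilon> y)) \<and>
      (\<exists>A. (\<exists>Q. mem_pairs y Q \<and> A = mem_structure y Q) \<and>
        (\<forall>\<sigma>. holds e 5 (undefined(0 := x, Suc 0 := y, 2 := mem_language, 3 := A, 4 := \<sigma>))
          (is_zfc_axiom 4) \<longrightarrow> Models mem_language A \<sigma>))"
    by (simp add: Loc_ZFC_def models_zfc_def numeral_eq_Suc)
  then obtain y Q where y: "x \<epsilon> y" "\<forall>a. a \<epsilon> y \<longrightarrow> (\<forall>b. b \<epsilon> a \<longrightarrow> b \<epsilon> y)" "mem_pairs y Q"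
    and ax: "\<And>\<sigma>. holds e 5 (undefined(0 := x, Suc 0 := y, 2 := mem_language,
        3 := mem_structure y Q, 4 := \<sigma>)) (is_zfc_axiom 4)
      \<Longrightarrow> Models mem_language (mem_structure y Q) \<sigma>"
    by blast
  have "Models mem_language (mem_structure y Q) (code 0 (p 0))" if "p \<in> set zfc_single_axioms" for p
    using that by (intro ax holds_is_zfc_axiom) auto
  with y show ?thesis by blast
qed

section \<open>Internal satisfaction of standard formulas\<close>

lemma Maps_unique: "Maps s V M \<Longrightarrow> pr i a \<epsilon> s \<Longrightarrow> pr i b \<epsilon> s \<Longrightarrow> a = b"
  unfolding Maps_def Fun_def by (metis pr_inject)

lemma Maps_dom: "Maps s V M \<Longrightarrow> pr i a \<epsilon> s \<Longrightarrow> i \<epsilon> V \<and> a \<epsilon> M"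
  unfolding Maps_def Fun_def by (metis pr_inject)

lemma Maps_total: "Maps s V M \<Longrightarrow> i \<epsilon> V \<Longrightarrow> \<exists>a. pr i a \<epsilon> s \<and> a \<epsilon> M"
  unfolding Maps_def Fun_def by metis

lemma Maps_sg: "a \<epsilon> M \<Longrightarrow> Maps (sg (pr x a)) (sg x) M"
  by (simp add: Maps_def)

text \<open>The changed assignment is obtained from difference, product and union, operations that
  already exist in \<open>bst_inf\<close>.\<close>

definition update :: "'a \<Rightarrow> 'a \<Rightarrow> 'a \<Rightarrow> 'a \<Rightarrow> 'a" where
  "update M s i a = un (diff s (prod (sg i) M)) (sg (pr i a))"

lemma pr_in_update:
  assumes "Maps s V M"
  shows "pr j b \<epsilon> update M s i a \<longleftrightarrow> (if j = i then b = a else pr j b \<epsilon> s)"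
  using Maps_dom[OF assms] by (auto simp: update_def)

lemma Variant_update:
  assumes "Maps s V M" and "i \<epsilon> V" and "a \<epsilon> M"
  shows "Variant V M i s (update M s i a)"
proof -
  have "\<exists>x y. x \<epsilon> V \<and> p = pr x y" if "p \<epsilon> update M s i a" for p
    using that assms(1,2) unfolding update_def Maps_def Fun_def by auto
  moreover have "\<exists>b. pr j b \<epsilon> update M s i a \<and> (\<forall>c. pr j c \<epsilon> update M s i a \<longrightarrow> c = b)"
    if "j \<epsilon> V" for j
    using Maps_total[OF assms(1) that] Maps_unique[OF assms(1)]
    by (auto simp: pr_in_update[OF assms(1)])
  moreover have "b \<epsilon> M" if "pr j b \<epsilon> update M s i a" for j b
    using that assms(3) Maps_dom[OF assms(1)] by (auto simp: pr_in_update[OF assms(1)] split: if_splits)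
  ultimately show ?thesis
    using assms(1) by (auto simp: Variant_def pr_in_update[OF assms(1)] Maps_def[of "update M s i a"]
        Fun_def[of "update M s i a"])
qed

text \<open>The tag 0 rules out the clause for function terms; conversely a formation sequence with
  the variable as its only entry evaluates it.\<close>

lemma Value_var:
  assumes s: "Maps s V y"
  shows "Value mem_language (mem_structure y Q) V s (tag 0 i) a \<longleftrightarrow> pr i a \<epsilon> s"
proof
  assume "Value mem_language (mem_structure y Q) V s (tag 0 i) a"
  then obtain h where "pr (tag 0 i) a \<epsilon> h"
    "\<forall>u b. pr u b \<epsilon> h \<longrightarrow> (\<exists>i. u = tag 0 i \<and> pr i b \<epsilon> s) \<or>
      (\<exists>f w. u = tag 1 (pr f w))"
    unfolding Value_def by blast
  then show "pr i a \<epsilon> s" by fastforce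
next
  assume a: "pr i a \<epsilon> s"
  let ?t = "tag 0 i"
  show "Value mem_language (mem_structure y Q) V s ?t a"
    unfolding Value_def
  proof (intro exI conjI)
    show "mem_structure y Q = pr y (pr (sg (pr em Q)) em)" by (rule mem_structure_def)
    show "pr (sg (pr em Q)) em = pr (sg (pr em Q)) em" ..
    show "Term_seq mem_language V (sg (pr em ?t))"
      unfolding Term_seq_def
    proof (intro exI conjI allI impI)
      show "mem_language = pr (sg (pr (nm 0) (nm 2))) em" by (rule mem_language_def)
      show "Natural (sg em)" by (rule Natural_sg_em)
      show "Fun (sg (pr em ?t)) (sg em)" by (rule Fun_sg)
    qed (use Maps_dom[OF s a] in auto)
    show "Entry (sg (pr em ?t)) ?t" by simp
    show "\<forall>u. u \<epsilon> sg ?t \<longleftrightarrow> Entry (sg (pr em ?t)) u" by simp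
    show "Maps (sg (pr ?t a)) (sg ?t) y" using Maps_dom[OF s a] by (simp add: Maps_sg)
    show "pr ?t a \<epsilon> sg (pr ?t a)" by simp
  qed (use a in auto)
qed

lemma Values_seq2:
  assumes s: "Maps s V y" and a: "pr i a \<epsilon> s" and b: "pr j b \<epsilon> s"
  shows "Values mem_language (mem_structure y Q) V s (seq2 (tag 0 i) (tag 0 j)) (seq2 c d)
    \<longleftrightarrow> c = a \<and> d = b"
proof
  assume "Values mem_language (mem_structure y Q) V s (seq2 (tag 0 i) (tag 0 j)) (seq2 c d)"
  then have "\<And>l t a. pr l t \<epsilon> seq2 (tag 0 i) (tag 0 j) \<Longrightarrow> pr l a \<epsilon> seq2 c d \<Longrightarrow>
      Value mem_language (mem_structure y Q) V s t a"
    unfolding Values_def by blast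
  from this[of "nm 0" "tag 0 i" c] this[of "nm 1" "tag 0 j" d]
  have "pr i c \<epsilon> s" "pr j d \<epsilon> s" by (simp_all add: pr_in_seq2 Value_var[OF s] del: nm.simps)
  with a b show "c = a \<and> d = b" using Maps_unique[OF s] by blast
next
  assume "c = a \<and> d = b"
  moreover have "Value mem_language (mem_structure y Q) V s t x"
    if "pr l t \<epsilon> seq2 (tag 0 i) (tag 0 j)" "pr l x \<epsilon> seq2 a b" for l t x
    using that a b by (auto simp: pr_in_seq2 Value_var[OF s] simp del: nm.simps)
  ultimately show "Values mem_language (mem_structure y Q) V s (seq2 (tag 0 i) (tag 0 j)) (seq2 c d)"
    unfolding Values_def using Fun_seq2 by blast
qed

text \<open>The tags make codes uniquely readable, so an entry can only have been justified by its
  immediate subformulas occurring earlier.\<close>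

lemma Formula_seq_entry:
  assumes "Formula_seq L V c"
  shows "Entry c (tag 5 (pr p q)) \<Longrightarrow> Entry c p \<and> Entry c q"
    and "Entry c (tag 6 (pr i p)) \<Longrightarrow> i \<epsilon> V \<and> Entry c p"
  using assms unfolding Formula_seq_def Entry_def Earlier_def by fastforce+

lemma Sat_relation_iff:
  assumes S: "Sat_relation mem_language (mem_structure y Q) V c S"
    and "Entry c \<phi>" and "Maps s V y"
  shows "pr \<phi> s \<epsilon> S \<longleftrightarrow>
    (\<exists>t u a. \<phi> = tag 2 (pr t u) \<and> Value mem_language (mem_structure y Q) V s t a \<and>
      Value mem_language (mem_structure y Q) V s u a) \<or>
    (\<exists>w x. \<phi> = tag 3 (pr em w) \<and> Values mem_language (mem_structure y Q) V s w x \<and> x \<epsilon> Q) \<or>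
    (\<exists>p q. \<phi> = tag 5 (pr p q) \<and> (pr p s \<epsilon> S \<longrightarrow> pr q s \<epsilon> S)) \<or>
    (\<exists>i p. \<phi> = tag 6 (pr i p) \<and> (\<forall>s'. Variant V y i s s' \<longrightarrow> pr p s' \<epsilon> S))"
proof -
  obtain M I P G where A: "mem_structure y Q = pr M I" "I = pr P G"
    and *: "\<forall>\<phi> s. Entry c \<phi> \<and> Maps s V M \<longrightarrow> (pr \<phi> s \<epsilon> S \<longleftrightarrow>
      (\<exists>t u a. \<phi> = tag 2 (pr t u) \<and> Value mem_language (mem_structure y Q) V s t a \<and>
        Value mem_language (mem_structure y Q) V s u a) \<or>
      (\<exists>r w p x. \<phi> = tag 3 (pr r w) \<and> pr r p \<epsilon> P \<and>
        Values mem_language (mem_structure y Q) V s w x \<and> x \<epsilon> p) \<or>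
      (\<exists>p q. \<phi> = tag 5 (pr p q) \<and> (pr p s \<epsilon> S \<longrightarrow> pr q s \<epsilon> S)) \<or>
      (\<exists>i p. \<phi> = tag 6 (pr i p) \<and> (\<forall>s'. Variant V M i s s' \<longrightarrow> pr p s' \<epsilon> S)))"
    using S unfolding Sat_relation_def by (elim exE conjE)
  from A have M: "M = y" and P: "P = sg (pr em Q)" by (auto simp: mem_structure_def)
  from *[unfolded M P, rule_format, OF conjI, OF assms(2,3)] show ?thesis by simp
qed

text \<open>Induction on the formula outside the model: Tarski's clauses pin down any satisfaction
  relation on standard codes, whatever it does elsewhere. The environment \<open>e\<close> lists by
  index what the internal assignment \<open>s\<close> lists by level.\<close>

lemma truth:
  assumes Q: "mem_pairs y Q" and c: "Formula_seq mem_language V c"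
    and S: "Sat_relation mem_language (mem_structure y Q) V c S"
  shows "Entry c (code k \<phi>) \<Longrightarrow> fv \<phi> \<subseteq> {..<k} \<Longrightarrow> Maps s V y \<Longrightarrow>
    \<forall>i<k. pr (nm (k - Suc i)) (e i) \<epsilon> s \<Longrightarrow>
    pr (code k \<phi>) s \<epsilon> S \<longleftrightarrow> ev {a. a \<epsilon> y} E e \<phi>"
proof (induction \<phi> arbitrary: k s e)
  case (MemF i j)
  note sat = Sat_relation_iff[OF S MemF.prems(1,3)]
  have s: "pr (nm (k - Suc i)) (e i) \<epsilon> s" "pr (nm (k - Suc j)) (e j) \<epsilon> s"
    using MemF.prems(2,4) by auto
  have "e i \<epsilon> y" "e j \<epsilon> y" using Maps_dom[OF MemF.prems(3)] s by blast+
  have "pr (code k (MemF i j)) s \<epsilon> S \<longleftrightarrow> (\<exists>x. x \<epsilon> Q \<and> Values mem_language (mem_structure y Q) V s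
      (seq2 (tag 0 (nm (k - Suc i))) (tag 0 (nm (k - Suc j)))) x)"
    unfolding sat by auto
  also have "\<dots> \<longleftrightarrow> (\<exists>a b. a \<epsilon> y \<and> b \<epsilon> y \<and> a \<epsilon> b \<and> Values mem_language (mem_structure y Q) V s
      (seq2 (tag 0 (nm (k - Suc i))) (tag 0 (nm (k - Suc j)))) (seq2 a b))"
    by (rule mem_pairs_ex[OF Q])
  also have "\<dots> \<longleftrightarrow> e i \<epsilon> e j"
    using \<open>e i \<epsilon> y\<close> \<open>e j \<epsilon> y\<close> by (auto simp: Values_seq2[OF MemF.prems(3) s])
  finally show ?case by simp
next
  case (EqF i j)
  note sat = Sat_relation_iff[OF S EqF.prems(1,3)]
  have s: "pr (nm (k - Suc i)) (e i) \<epsilon> s" "pr (nm (k - Suc j)) (e j) \<epsilon> s"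
    using EqF.prems(2,4) by auto
  have "pr (code k (EqF i j)) s \<epsilon> S \<longleftrightarrow>
      (\<exists>a. pr (nm (k - Suc i)) a \<epsilon> s \<and> pr (nm (k - Suc j)) a \<epsilon> s)"
    unfolding sat by (auto simp: Value_var[OF EqF.prems(3)])
  also have "\<dots> \<longleftrightarrow> e i = e j" using s Maps_unique[OF EqF.prems(3)] by metis
  finally show ?case by simp
next
  case BotF
  then show ?case using Sat_relation_iff[OF S BotF.prems(1,3)] by simp
next
  case (ImpF \<phi> \<psi>)
  have "Entry c (code k \<phi>)" "Entry c (code k \<psi>)"
    using Formula_seq_entry(1)[OF c, of "code k \<phi>" "code k \<psi>"] ImpF.prems(1) by simp_all
  moreover have "pr (code k (ImpF \<phi> \<psi>)) s \<epsilon> S \<longleftrightarrow> (pr (code k \<phi>) s \<epsilon> S \<longrightarrow> pr (code k \<psi>) s \<epsilon> S)"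
    unfolding Sat_relation_iff[OF S ImpF.prems(1,3)] by simp
  ultimately show ?case using ImpF by simp
next
  case (AllF \<phi>)
  have k: "nm k \<epsilon> V" "Entry c (code (Suc k) \<phi>)"
    using Formula_seq_entry(2)[OF c, of "nm k" "code (Suc k) \<phi>"] AllF.prems(1) by simp_all
  have fv: "fv \<phi> \<subseteq> {..<Suc k}"
    using AllF.prems(2) by (auto simp: subset_iff) (metis Suc_less_eq not0_implies_Suc zero_less_Suc)
  have IH: "pr (code (Suc k) \<phi>) s' \<epsilon> S \<longleftrightarrow> ev {a. a \<epsilon> y} E (case_nat a e) \<phi>"
    if s': "Variant V y (nm k) s s'" "pr (nm k) a \<epsilon> s'" for s' a
  proof (rule AllF.IH[OF k(2) fv])
    show "Maps s' V y" using s'(1) by (simp add: Variant_def)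
    have "pr (nm (k - Suc i)) (e i) \<epsilon> s'" if "i < k" for i
    proof -
      have "pr (nm (k - Suc i)) (e i) \<epsilon> s" using AllF.prems(4) that by blast
      moreover have "nm (k - Suc i) \<noteq> nm k" using that by simp
      \<comment> \<open>The variables bound further out have levels below \<open>k\<close>, so a
        variant at \<open>nm k\<close> leaves their values alone.\<close>
      ultimately show ?thesis using s'(1) Maps_dom[OF AllF.prems(3)] by (metis Variant_def)
    qed
    then show "\<forall>i<Suc k. pr (nm (Suc k - Suc i)) (case_nat a e i) \<epsilon> s'"
      using s'(2) by (auto split: nat.split)
  qed
  have "pr (code k (AllF \<phi>)) s \<epsilon> S \<longleftrightarrow>
      (\<forall>s'. Variant V y (nm k) s s' \<longrightarrow> pr (code (Suc k) \<phi>) s' \<epsilon> S)"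
    unfolding Sat_relation_iff[OF S AllF.prems(1,3)] by simp
  \<comment> \<open>Variants of \<open>s\<close> at \<open>nm k\<close> and elements of
    \<open>y\<close> correspond: every element is reached by \<open>update\<close>, and every
    variant has a value at \<open>nm k\<close>.\<close>
  also have "\<dots> \<longleftrightarrow> (\<forall>a. a \<epsilon> y \<longrightarrow> ev {a. a \<epsilon> y} E (case_nat a e) \<phi>)"
  proof (intro iffI allI impI)
    fix a
    assume "\<forall>s'. Variant V y (nm k) s s' \<longrightarrow> pr (code (Suc k) \<phi>) s' \<epsilon> S" and "a \<epsilon> y"
    moreover have "Variant V y (nm k) s (update y s (nm k) a)"
      using AllF.prems(3) k(1) \<open>a \<epsilon> y\<close> by (rule Variant_update)
    moreover have "pr (nm k) a \<epsilon> update y s (nm k) a"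
      by (simp add: pr_in_update[OF AllF.prems(3)])
    ultimately show "ev {a. a \<epsilon> y} E (case_nat a e) \<phi>" using IH by blast
  next
    fix s'
    assume all: "\<forall>a. a \<epsilon> y \<longrightarrow> ev {a. a \<epsilon> y} E (case_nat a e) \<phi>" and s': "Variant V y (nm k) s s'"
    then obtain a where "pr (nm k) a \<epsilon> s'" "a \<epsilon> y"
      using Maps_total k(1) unfolding Variant_def by blast
    with all IH s' show "pr (code (Suc k) \<phi>) s' \<epsilon> S" by blast
  qed
  finally show ?case by simp
qed

lemma Models_code:
  assumes "mem_pairs y Q" and "Models mem_language (mem_structure y Q) (code 0 \<phi>)"
    and "x \<epsilon> y" and "fv \<phi> = {}"
  shows "ev {a. a \<epsilon> y} E e \<phi>"
proof -
  obtain V M I where VM: "mem_structure y Q = pr M I"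
      "\<forall>s. Maps s V M \<longrightarrow> Sat mem_language (mem_structure y Q) s (code 0 \<phi>)"
    using assms(2) unfolding Models_def by blast
  then have "M = y" by (simp add: mem_structure_def)
  \<comment> \<open>Internal validity quantifies over assignments, so one must be exhibited: the
    constant one with value \<open>x\<close>.\<close>
  moreover have "Maps (prod V (sg x)) V y" using assms(3) by (simp add: Maps_def Fun_const)
  ultimately have "Sat mem_language (mem_structure y Q) (prod V (sg x)) (code 0 \<phi>)"
    using VM(2) by blast
  then obtain V' M' I' c S where *: "mem_structure y Q = pr M' I'" "Maps (prod V (sg x)) V' M'"
      "Formula_seq mem_language V' c" "Entry c (code 0 \<phi>)"
      "Sat_relation mem_language (mem_structure y Q) V' c S" "pr (code 0 \<phi>) (prod V (sg x)) \<epsilon> S"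
    unfolding Sat_def by blast
  then have "M' = y" by (simp add: mem_structure_def)
  with * truth[OF assms(1) *(3,5,4), of "prod V (sg x)" e] assms(4) show ?thesis by simp
qed

section \<open>Foundation and Choice by absoluteness for transitive sets\<close>

text \<open>Transitivity puts all elements of x into y, so a minimal element of x found in the model
  y is minimal outright.\<close>

lemma ev_foundation_ax:
  assumes "ev UNIV E e (Loc_ZFC 0)"
  shows "ev UNIV E e (foundation_ax 0)"
proof -
  have "\<exists>z. z \<epsilon> x \<and> \<not> (\<exists>w. w \<epsilon> x \<and> w \<epsilon> z)" if "z \<epsilon> x" for x z
  proof -
    obtain y Q where y: "x \<epsilon> y" "\<forall>a. a \<epsilon> y \<longrightarrow> (\<forall>b. b \<epsilon> a \<longrightarrow> b \<epsilon> y)" "mem_pairs y Q"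
      "\<forall>p\<in>set zfc_single_axioms. Models mem_language (mem_structure y Q) (code 0 (p 0))"
      using Loc_ZFC_code[OF assms] by blast
    have "hold {a. a \<epsilon> y} E e 0 undefined foundation_ax"
      unfolding hold_def level_env_0
      using y sentence_foundation by (intro Models_code) (auto simp: sentence_def zfc_single_axioms_def)
    then show ?thesis using y(1,2) that by (simp add: foundation_ax_def) metis
  qed
  then have "holds e 0 undefined foundation_ax" by (auto simp: foundation_ax_def)
  then show ?thesis by (simp add: hold_def)
qed

lemma ev_choice_ax:
  assumes "ev UNIV E e (Loc_ZFC 0)"
  shows "ev UNIV E e (choice_ax 0)"
proof -
  have "\<exists>f. Fun f x \<and> (\<forall>y z. pr y z \<epsilon> f \<longrightarrow> z \<epsilon> y)" if x: "\<forall>y. y \<epsilon> x \<longrightarrow> (\<exists>z. z \<epsilon> y)" for x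
  proof -
    obtain y Q where y: "x \<epsilon> y" "\<forall>a. a \<epsilon> y \<longrightarrow> (\<forall>b. b \<epsilon> a \<longrightarrow> b \<epsilon> y)" "mem_pairs y Q"
      "\<forall>p\<in>set zfc_single_axioms. Models mem_language (mem_structure y Q) (code 0 (p 0))"
      using Loc_ZFC_code[OF assms] by blast
    let ?U = "{a. a \<epsilon> y}"
    have hold: "hold ?U E e 0 undefined choice_ax"
      unfolding hold_def level_env_0
      using y sentence_choice by (intro Models_code) (auto simp: sentence_def zfc_single_axioms_def)
    \<comment> \<open>Elements of a member of \<open>y\<close> are in \<open>y\<close>, so
      quantifying over \<open>y\<close> alone already determines the members of
      \<open>c\<close>.\<close>
    have up: "(\<forall>w. w \<epsilon> y \<longrightarrow> (w \<epsilon> c \<longleftrightarrow> w = a \<or> w = b)) \<longleftrightarrow> c = up a b"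
      if "a \<epsilon> y" "b \<epsilon> y" "c \<epsilon> y" for a b c
    proof
      assume "\<forall>w. w \<epsilon> y \<longrightarrow> (w \<epsilon> c \<longleftrightarrow> w = a \<or> w = b)"
      then have "w \<epsilon> c \<longleftrightarrow> w \<epsilon> up a b" for w
        unfolding in_up using that y(2) by metis
      then show "c = up a b" by (rule ext)
    qed simp
    have sg: "(\<forall>w. w \<epsilon> y \<longrightarrow> (w \<epsilon> c \<longleftrightarrow> w = a)) \<longleftrightarrow> c = sg a" if "a \<epsilon> y" "c \<epsilon> y" for a c
      using up[OF that(1,1,2)] by (simp add: sg_def)
    have pair: "hold ?U E e d v (is_pair i j k) = (v k = pr (v i) (v j))"
      if "i < d" "j < d" "k < d" "v i \<epsilon> y" "v j \<epsilon> y" "v k \<epsilon> y" for i j k d v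
    proof -
      have "hold ?U E e d v (is_pair i j k) \<longleftrightarrow>
          (\<exists>a. a \<epsilon> y \<and> (\<exists>b. b \<epsilon> y \<and> a = sg (v i) \<and> b = up (v i) (v j) \<and> v k = up a b))"
        using that by (simp add: is_pair_def is_upair_def up sg cong: conj_cong)
      \<comment> \<open>The two components of the pair are elements of \<open>v k\<close> and hence
        available in \<open>y\<close> as witnesses.\<close>
      also have "\<dots> \<longleftrightarrow> v k = pr (v i) (v j)"
        unfolding pr_def using that y(2) by (metis in_up)
      finally show ?thesis .
    qed
    have pr_dom: "pr a b \<epsilon> y \<and> a \<epsilon> y \<and> b \<epsilon> y" if "pr a b \<epsilon> f" "f \<epsilon> y" for a b f
      using that y(2) unfolding pr_def by (metis in_up)
    have pair_in: "hold ?U E e d v (pair_in i j k) = (pr (v i) (v j) \<epsilon> v k)"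
      if "i < d" "j < d" "k < d" "v i \<epsilon> y" "v j \<epsilon> y" "v k \<epsilon> y" for i j k d v
      using that pr_dom by (auto simp: pair_in_def pair)
    have Fun: "hold ?U E e d v (is_function i j) = Fun (v i) (v j)"
      if "i < d" "j < d" "v i \<epsilon> y" "v j \<epsilon> y" for i j d v
    proof -
      have "hold ?U E e d v (is_function i j) \<longleftrightarrow>
          (\<forall>p. p \<epsilon> y \<longrightarrow> p \<epsilon> v i \<longrightarrow> (\<exists>a. a \<epsilon> y \<and> a \<epsilon> v j \<and> (\<exists>b. b \<epsilon> y \<and> p = pr a b))) \<and>
          (\<forall>a. a \<epsilon> y \<longrightarrow> a \<epsilon> v j \<longrightarrow> (\<exists>b. b \<epsilon> y \<and> pr a b \<epsilon> v i \<and>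
            (\<forall>c. c \<epsilon> y \<longrightarrow> pr a c \<epsilon> v i \<longrightarrow> c = b)))"
        using that by (simp add: is_function_def pair pair_in cong: conj_cong imp_cong)
      also have "\<dots> \<longleftrightarrow> Fun (v i) (v j)"
      proof -
        have dom: "p \<epsilon> y" if "p \<epsilon> v i" for p using that \<open>v i \<epsilon> y\<close> y(2) by blast
        have arg: "a \<epsilon> y" if "a \<epsilon> v j" for a using that \<open>v j \<epsilon> y\<close> y(2) by blast
        have val: "b \<epsilon> y" if "pr a b \<epsilon> v i" for a b using pr_dom[OF that \<open>v i \<epsilon> y\<close>] by blast
        have "(\<forall>p. p \<epsilon> y \<longrightarrow> p \<epsilon> v i \<longrightarrow> (\<exists>a. a \<epsilon> y \<and> a \<epsilon> v j \<and> (\<exists>b. b \<epsilon> y \<and> p = pr a b)))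
            \<longleftrightarrow> (\<forall>p. p \<epsilon> v i \<longrightarrow> (\<exists>a b. a \<epsilon> v j \<and> p = pr a b))"
          using dom arg val by blast
        moreover have "(\<exists>b. b \<epsilon> y \<and> pr a b \<epsilon> v i \<and> (\<forall>c. c \<epsilon> y \<longrightarrow> pr a c \<epsilon> v i \<longrightarrow> c = b))
            \<longleftrightarrow> (\<exists>b. pr a b \<epsilon> v i \<and> (\<forall>c. pr a c \<epsilon> v i \<longrightarrow> c = b))" for a
          using val by blast
        ultimately show ?thesis unfolding Fun_def using arg by auto
      qed
      finally show ?thesis .
    qed
    have "\<forall>x. x \<epsilon> y \<longrightarrow> (\<forall>z. z \<epsilon> y \<longrightarrow> z \<epsilon> x \<longrightarrow> (\<exists>w. w \<epsilon> y \<and> w \<epsilon> z)) \<longrightarrow>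
        (\<exists>f. f \<epsilon> y \<and> Fun f x \<and> (\<forall>a. a \<epsilon> y \<longrightarrow> (\<forall>b. b \<epsilon> y \<longrightarrow> pr a b \<epsilon> f \<longrightarrow> b \<epsilon> a)))"
      using hold by (simp add: choice_ax_def Fun pair_in cong: conj_cong imp_cong)
    moreover have "\<forall>z. z \<epsilon> y \<longrightarrow> z \<epsilon> x \<longrightarrow> (\<exists>w. w \<epsilon> y \<and> w \<epsilon> z)"
      using x y(2) by blast
    ultimately obtain f where f: "f \<epsilon> y" "Fun f x"
        "\<forall>a. a \<epsilon> y \<longrightarrow> (\<forall>b. b \<epsilon> y \<longrightarrow> pr a b \<epsilon> f \<longrightarrow> b \<epsilon> a)"
      using y(1) by blast
    \<comment> \<open>Arguments and values of \<open>f\<close> lie in \<open>y\<close>, so the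
      bounded choice property is the full one.\<close>
    then have "\<forall>a b. pr a b \<epsilon> f \<longrightarrow> b \<epsilon> a" using pr_dom by blast
    with f(2) show ?thesis by blast
  qed
  then have "holds e 0 undefined choice_ax" by (simp add: choice_ax_def)
  then show ?thesis by (simp add: hold_def)
qed

end


section \<open>The axioms of BST and of ZFC in a model\<close>

definition diff_ax :: fm where
  "diff_ax = separation_ax (NegF (MemF 0 1)) 1"

text \<open>The formula says that \<open>{{x}}\<close> is an element of the parameter.\<close>

definition extract_formula :: fm where
  "extract_formula = ExF (AndF (MemF 0 2) (AndF (ExF (AndF (MemF 0 1) (EqF 0 0)))
     (AllF (ImpF (MemF 0 1) (AndF (MemF 2 0) (AllF (ImpF (MemF 0 1) (EqF 0 3))))))))"

definition extract_ax :: fm where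
  "extract_ax = separation_ax extract_formula 1"

text \<open>Finitely many axioms of \<open>BST\<close> that already make a model an interpretation
  of \<open>bst_inf\<close>; all are sentences and therefore pass from LZFC to T.\<close>

definition core_axioms :: "fm set" where
  "core_axioms = {empty_set_ax 0, extensionality_ax 0, pair_ax 0, union_ax 0,
     cartesian_product_ax 0, omega_ax 0, diff_ax, extract_ax}"

lemma core_axioms_BST: "core_axioms \<subseteq> BST"
proof -
  have d1: "delta0 (NegF (MemF 0 1))"
    by (intro delta0.intros)
  have *: "delta0 (AllF (ImpF (MemF 0 1) \<phi>))" "delta0 (ExF (AndF (MemF 0 1) \<phi>))"
      "delta0 (ExF (AndF (MemF 0 2) \<phi>))" if "delta0 \<phi>" for \<phi>
    using delta0.intros(5,6)[OF that, of 0] delta0.intros(6)[OF that, of 1]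
    by (simp_all add: numeral_2_eq_2)
  have d2: "delta0 extract_formula"
    unfolding extract_formula_def by (intro * delta0.intros(1-4))
  have fv: "fv extract_formula \<subseteq> {..<1 + 1}"
    by (auto simp: extract_formula_def)
  have "diff_ax \<in> {separation_ax \<phi> k | \<phi> k. delta0 \<phi> \<and> fv \<phi> \<subseteq> {..<k + 1}}"
    unfolding diff_ax_def using d1 by force
  moreover have "extract_ax \<in> {separation_ax \<phi> k | \<phi> k. delta0 \<phi> \<and> fv \<phi> \<subseteq> {..<k + 1}}"
    unfolding extract_ax_def using d2 fv by blast
  ultimately show ?thesis by (auto simp: core_axioms_def BST_def)
qed

lemma sentence_core_axioms: "\<phi> \<in> core_axioms \<Longrightarrow> sentence \<phi>"
  unfolding core_axioms_def
  by (auto simp: sentence_def empty_set_ax_def extensionality_ax_def pair_ax_def union_ax_def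
      cartesian_product_ax_def omega_ax_def diff_ax_def extract_ax_def extract_formula_def separation_ax_def close_def
      app1_def fv_ren is_omega_def is_inductive_def is_succ_def is_subset_def is_empty_def is_pair_def
      is_upair_def all_def ex_def imp_def iff_def conj_def disj_def neg_def mem_def eq_def
      split: nat.splits)

lemma ev_separation_ax:
  assumes "fv \<phi> \<subseteq> {..<k + 1}"
  shows "ev UNIV E e (separation_ax \<phi> k) \<longleftrightarrow>
    (\<forall>v a. \<exists>b. \<forall>x. E x b \<longleftrightarrow> E x a \<and> ev UNIV E (case_nat x v) \<phi>)"
proof -
  \<comment> \<open>The quantified a, b and x occupy the levels from \<open>k\<close> on, above the
    parameters of \<open>\<phi>\<close>.\<close>
  have "ev UNIV E (case_nat x (v(k := a, Suc k := b, Suc (Suc k) := x))) \<phi> = ev UNIV E (case_nat x v) \<phi>"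
    for a b x v
    using assms by (intro ev_cong) (force split: nat.split)
  then show ?thesis
    unfolding separation_ax_def ev_close using assms by (simp add: hold_app1)
qed

text \<open>The bounded way to say u = {{x}}: u is nonempty and each of its elements has x as its
  only element. The conjunct \<open>EqF 0 0\<close> just fills the body that the shape of a bounded
  existential requires.\<close>

lemma ev_extract_formula:
  "ev UNIV E (case_nat x v) extract_formula \<longleftrightarrow>
    (\<exists>u. E u (v 0) \<and> (\<exists>m. E m u) \<and> (\<forall>m. E m u \<longrightarrow> E x m \<and> (\<forall>t. E t m \<longrightarrow> t = x)))"
  by (simp only: extract_formula_def numeral_2_eq_2 numeral_3_eq_3 ev.simps nat.case One_nat_def
      UNIV_I ball_UNIV simp_thms not_all not_not not_imp) blast

lemma bst_inf_core:
  assumes "\<forall>\<phi>\<in>core_axioms. ev UNIV E e \<phi>"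
  shows "bst_inf E"
proof -
  have ax: "hold UNIV E e 0 undefined empty_set_ax" "hold UNIV E e 0 undefined extensionality_ax"
    "hold UNIV E e 0 undefined pair_ax" "hold UNIV E e 0 undefined union_ax"
    "hold UNIV E e 0 undefined cartesian_product_ax" "hold UNIV E e 0 undefined omega_ax"
    using assms by (simp_all add: hold_def core_axioms_def)
  have "fv (NegF (MemF 0 1)) \<subseteq> {..<1 + 1}" by auto
  note sep = ev_separation_ax[OF this, of E e]
  have "ev UNIV E e diff_ax" using assms by (simp add: core_axioms_def)
  then have diff: "\<forall>(v :: nat \<Rightarrow> _) a. \<exists>b. \<forall>x. E x b \<longleftrightarrow> E x a \<and> \<not> E x (v 0)"
    unfolding diff_ax_def sep by simp
  interpret bst E
  proof
    show "x = y" if "\<And>z. E z x \<longleftrightarrow> E z y" for x y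
      using ax(2) that by (simp add: extensionality_ax_def)
    show "\<exists>x. \<forall>y. \<not> E y x"
      using ax(1) by (simp add: empty_set_ax_def is_empty_def)
    show "\<exists>z. \<forall>w. E w z \<longleftrightarrow> w = x \<or> w = y" for x y
      using ax(3) by (simp add: pair_ax_def is_upair_def)
    show "\<exists>z. \<forall>w. E w z \<longleftrightarrow> (\<exists>y. E y x \<and> E w y)" for x
      using ax(4) by (simp add: union_ax_def)
    show "\<exists>b. \<forall>z. E z b \<longleftrightarrow> E z x \<and> \<not> E z y" for x y
      using diff[rule_format, of x "\<lambda>_. y"] by simp
  qed
  show ?thesis
  proof
    show "\<exists>z. \<forall>p. E p z \<longleftrightarrow> (\<exists>a b. E a x \<and> E b y \<and> p = pr a b)" for x y
      using ax(5) by (simp add: cartesian_product_ax_def)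
    show "\<exists>w. Omega w" using ax(6) by (simp add: omega_ax_def)
    let ?\<phi> = extract_formula
    have "fv ?\<phi> \<subseteq> {..<1 + 1}" by (auto simp: extract_formula_def)
    note sep = ev_separation_ax[OF this, of E e]
    have "ev UNIV E e extract_ax" using assms by (simp add: core_axioms_def)
    then have "\<forall>v a. \<exists>b. \<forall>x. E x b \<longleftrightarrow> E x a \<and> ev UNIV E (case_nat x v) ?\<phi>"
      unfolding extract_ax_def sep .
    moreover have "ev UNIV E (case_nat x v) ?\<phi> \<longleftrightarrow> E (sg (sg x)) (v 0)" for x and v :: "nat \<Rightarrow> _"
    proof -
      have "ev UNIV E (case_nat x v) ?\<phi> \<longleftrightarrow> (\<exists>u. E u (v 0) \<and> (\<exists>m. E m u) \<and>
          (\<forall>m. E m u \<longrightarrow> E x m \<and> (\<forall>t. E t m \<longrightarrow> t = x)))"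
        by (rule ev_extract_formula)
      also have "\<dots> \<longleftrightarrow> (\<exists>u. E u (v 0) \<and> u = sg (sg x))"
      proof -
        have "(E x m \<and> (\<forall>t. E t m \<longrightarrow> t = x)) \<longleftrightarrow> m = sg x" for m
          by (auto simp: set_eq_iff[of m])
        moreover have "((\<exists>m. E m u) \<and> (\<forall>m. E m u \<longrightarrow> m = sg x)) \<longleftrightarrow> u = sg (sg x)" for u
          by (auto simp: set_eq_iff[of u])
        ultimately show ?thesis by simp
      qed
      finally show ?thesis by simp
    qed
    ultimately have ex: "\<forall>(v :: nat \<Rightarrow> _) a. \<exists>b. \<forall>x. E x b \<longleftrightarrow> E x a \<and> E (sg (sg x)) (v 0)" by simp
    show "\<exists>b. \<forall>z. E z b \<longleftrightarrow> E z x \<and> E (sg (sg z)) y" for x y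
      using ex[rule_format, of x "\<lambda>_. y"] by simp
  qed
qed

lemma vp_model_VP:
  assumes "bst_inf E" and VP: "\<forall>\<phi>\<in>VP. ev UNIV E e \<phi>"
  shows "vp_model E"
proof -
  interpret bst_inf E by fact
  show ?thesis
  proof
    fix P L
    assume "definable P" and L: "Language L" and str: "\<And>x. P x \<Longrightarrow> Structure L x"
      and proper: "\<nexists>z. \<forall>x. E x z \<longleftrightarrow> P x"
    then obtain \<phi> k v where \<phi>: "fv \<phi> \<subseteq> {..<k + 1}" and P: "\<And>x. P x \<longleftrightarrow> ev UNIV E (case_nat x v) \<phi>"
      unfolding definable_def by blast
    have "vp_ax \<phi> k \<in> VP" using \<phi> by (auto simp: VP_def)
    with VP have "ev UNIV E e (vp_ax \<phi> k)" by blast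
    then have *: "holds e k v (\<^bold>\<forall>L. is_language L \<^bold>\<and> (\<^bold>\<forall>x. app1 \<phi> x \<^bold>\<longrightarrow> is_structure L x) \<^bold>\<and>
        \<^bold>\<not> (\<^bold>\<exists>z. \<^bold>\<forall>x. x \<^bold>\<in> z \<^bold>\<longleftrightarrow> app1 \<phi> x) \<^bold>\<longrightarrow>
        (\<^bold>\<exists>x y j. app1 \<phi> x \<^bold>\<and> app1 \<phi> y \<^bold>\<and> \<^bold>\<not> x \<^bold>= y \<^bold>\<and> is_elementary_embedding L x y j))"
      unfolding vp_ax_def ev_close by blast
    have app1: "holds e d w (app1 \<phi> x) = P (w x)" if "k \<le> d" "x < d" "\<forall>i<k. w i = v i" for d w x
      unfolding P hold_app1[OF \<phi> that(1,2)]
      using \<phi> that(3) by (intro ev_cong) (force split: nat.split)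
    from *[simplified, rule_format, of L] L str proper
    show "\<exists>x y j. P x \<and> P y \<and> x \<noteq> y \<and> Embedding L x y j"
      by (simp add: app1)
  qed
qed

lemma (in vp_model) ev_replacement_ax:
  assumes "fv \<phi> \<subseteq> {..<k + 2}"
  shows "ev UNIV E e (replacement_ax \<phi> k)"
  unfolding replacement_ax_def ev_close
proof (intro allI)
  fix v
  have app2: "holds e d w (app2 \<phi> x y) = ev UNIV E (case_nat (w x) (case_nat (w y) v)) \<phi>"
    if "k \<le> d" "x < d" "y < d" "\<forall>i<k. w i = v i" for d w x y
    unfolding hold_app2[OF assms that(1,2,3)]
    using assms that(4) by (intro ev_cong) (force split: nat.split)
  have "\<exists>b. \<forall>y. y \<epsilon> b \<longleftrightarrow> (\<exists>x. x \<epsilon> a \<and> ev UNIV E (case_nat x (case_nat y v)) \<phi>)"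
    if "\<forall>x. \<exists>u. \<forall>y. ev UNIV E (case_nat x (case_nat y v)) \<phi> \<longrightarrow> y = u" for a
  proof (rule replacement[OF assms])
    show "y = z" if "ev UNIV E (case_nat x (case_nat y v)) \<phi>"
      and "ev UNIV E (case_nat x (case_nat z v)) \<phi>" for x y z
      using that \<open>\<forall>x. \<exists>u. \<forall>y. ev UNIV E (case_nat x (case_nat y v)) \<phi> \<longrightarrow> y = u\<close> by metis
  qed simp
  then show "holds e k v ((\<^bold>\<forall>x. \<^bold>\<exists>u. \<^bold>\<forall>y. app2 \<phi> x y \<^bold>\<longrightarrow> y \<^bold>= u) \<^bold>\<longrightarrow>
      (\<^bold>\<forall>a. \<^bold>\<exists>b. \<^bold>\<forall>y. y \<^bold>\<in> b \<^bold>\<longleftrightarrow> (\<^bold>\<exists>x. x \<^bold>\<in> a \<^bold>\<and> app2 \<phi> x y)))"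
    by (simp add: app2)
qed

lemma (in vp_model) ev_power_set_ax: "ev UNIV E e (power_set_ax 0)"
proof -
  have "holds e 0 undefined power_set_ax" by (simp add: power_set_ax_def power_set)
  then show ?thesis by (simp add: hold_def)
qed

lemma (in bst_inf) ev_infinity_ax: "ev UNIV E e (infinity_ax 0)"
proof -
  have "holds e 0 undefined infinity_ax"
    using ex_omega by (auto simp: infinity_ax_def Omega_def)
  then show ?thesis by (simp add: hold_def)
qed

text \<open>Foundation and Choice are obtained as theorems of LZFC by completeness; in this form the
  inclusion of theorems hands them to T.\<close>

lemma LZFC_proves:
  assumes "\<And>(E :: nat \<Rightarrow> nat \<Rightarrow> bool) e. bst_inf E \<Longrightarrow> ev UNIV E e (Loc_ZFC 0) \<Longrightarrow> ev UNIV E e \<phi>"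
  shows "LZFC \<turnstile> \<phi>"
proof (rule completeness_nat)
  have "core_axioms \<subseteq> LZFC" using core_axioms_BST by (auto simp: LZFC_def)
  then show "LZFC \<turnstile> empty_set_ax 0" "LZFC \<turnstile> pair_ax 0"
    by (auto intro!: Assm simp: core_axioms_def)
  show "ev UNIV E e \<phi>" if "\<forall>\<phi>\<in>LZFC. ev UNIV E e \<phi>" for E :: "nat \<Rightarrow> nat \<Rightarrow> bool" and e
    using that \<open>core_axioms \<subseteq> LZFC\<close>
    by (intro assms bst_inf_core[of E e]) (auto simp: LZFC_def)
qed

theorem theorem6p3:
  fixes T :: "fm set"
  assumes "is_theory T"
    and "LZFC \<sqsubseteq>\<^sub>T T"
    and "T \<turnstile> VPH"
  shows "ZFC \<sqsubseteq>\<^sub>T T \<union> VP"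
proof -
  have T: "T \<turnstile> \<phi>" if "LZFC \<turnstile> \<phi>" "sentence \<phi>" for \<phi>
    using assms(2) that by (auto simp: subtheory_def theorems_def)
  have core: "T \<turnstile> \<phi>" if "\<phi> \<in> core_axioms" for \<phi>
  proof (rule T)
    have "\<phi> \<in> LZFC" using that core_axioms_BST by (auto simp: LZFC_def)
    then show "LZFC \<turnstile> \<phi>" by (rule Assm)
    show "sentence \<phi>" using that by (rule sentence_core_axioms)
  qed
  have found: "T \<turnstile> foundation_ax 0"
    by (intro T LZFC_proves bst_inf.ev_foundation_ax sentence_foundation)
  have choice: "T \<turnstile> choice_ax 0"
    by (intro T LZFC_proves bst_inf.ev_choice_ax sentence_choice)
  have "T \<union> VP \<turnstile> \<psi>" if "ZFC \<turnstile> \<psi>" for \<psi>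
  \<comment> \<open>It remains to show that a model of T + VP on \<open>nat\<close> satisfies each
    axiom of ZFC; soundness of the given derivation then yields \<open>\<psi>\<close> there.\<close>
  proof (rule completeness_nat)
    show "T \<union> VP \<turnstile> empty_set_ax 0" "T \<union> VP \<turnstile> pair_ax 0"
      using core by (auto intro: proves_mono simp: core_axioms_def)
  next
    fix E :: "nat \<Rightarrow> nat \<Rightarrow> bool" and e
    assume model: "\<forall>\<phi>\<in>T \<union> VP. ev UNIV E e \<phi>"
    then have ev: "ev UNIV E e \<phi>" if "T \<turnstile> \<phi>" for \<phi>
      using that soundness[of T \<phi> e UNIV E] by blast
    then have inf: "bst_inf E" using core bst_inf_core by blast
    interpret vp_model E using inf model by (intro vp_model_VP) auto
    have "ev UNIV E e \<phi>" if \<phi>: "\<phi> \<in> ZFC" for \<phi>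
    proof -
      consider "\<phi> \<in> (\<lambda>p. p 0) ` set zfc_single_axioms"
        | \<chi> k where "\<phi> = separation_ax \<chi> k" "fv \<chi> \<subseteq> {..<k + 1}"
        | \<chi> k where "\<phi> = replacement_ax \<chi> k" "fv \<chi> \<subseteq> {..<k + 2}"
        using \<phi> unfolding ZFC_def by blast
      then show ?thesis
      proof cases
        case 1
        \<comment> \<open>Extensionality, Pair and Union are shared with \<open>BST\<close>; the
          other single axioms have their own arguments.\<close>
        then consider "\<phi> \<in> core_axioms" | "\<phi> = foundation_ax 0" | "\<phi> = power_set_ax 0"
          | "\<phi> = infinity_ax 0" | "\<phi> = choice_ax 0"
          by (auto simp: zfc_single_axioms_def core_axioms_def)
        then show ?thesis
          by cases (simp_all add: ev core found choice ev_power_set_ax ev_infinity_ax)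
      next
        case 2
        then show ?thesis by (simp add: ev_separation_ax separation)
      next
        case 3
        then show ?thesis by (simp add: ev_replacement_ax)
      qed
    qed
    then show "ev UNIV E e \<psi>" using soundness[OF that, of e UNIV E] by blast
  qed
  then show ?thesis by (auto simp: subtheory_def theorems_def)
qed

end
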